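(* Let $\phi_{1,1},\phi_{1,2}:\mathbb{R}\to\mathbb{R}$ be real analytic functions with $\phi_{1,1}'\phi_{1,2}'=1$ and with $\phi_{1,1}''$ and $\phi_{1,2}''$ nowhere zero, and let $\mathcal{M}_\Phi=(\mathbb{R}^{14},g_\Phi)$ be the associated pseudo-Riemannian manifold defined in the context. Then: (1) $\Xi:=\{1-\phi_{1,1}'\phi_{1,1}'''(\phi_{1,1}'')^{-2}\}^2$ is a local isometry invariant of $\mathcal{M}_\Phi$. (2) If $\phi_{1,1}'(x_1)$ is not of the form $be^{cx_1}$ for constants $b,c\in\mathbb{R}$, then $\Xi$ is not locally constant and hence $\mathcal{M}_\Phi$ is not locally homogeneous.
   Context: Let $\{x_i,x_i^*,y_{i,1},y_{i,2},y_{4,1},y_{4,2}\}$, $1\le i\le3$, be coordinates on $\mathbb{R}^{14}$. The non-zero components of $g_\Phi$ are, up to symmetry: $g_\Phi(\partial_{x_i},\partial_{x_i^*})=g_\Phi(\partial_{y_{i,1}},\partial_{y_{i,2}})=1$ for $1\le i\le3$; $g_\Phi(\partial_{y_{4,1}},\partial_{y_{4,1}})=g_\Phi(\partial_{y_{4,2}},\partial_{y_{4,2}})=-\frac12$, $g_\Phi(\partial_{y_{4,1}},\partial_{y_{4,2}})=\frac14$; $g_\Phi(\partial_{x_1},\partial_{x_1})=-2x_2y_{2,1}-2x_3y_{3,1}$; $g_\Phi(\partial_{x_2},\partial_{x_2})=-2x_3y_{3,2}-2\phi_{1,2}(x_1)y_{1,2}$; $g_\Phi(\partial_{x_3},\partial_{x_3})=-2\phi_{1,1}(x_1)y_{1,1}-2x_2y_{2,2}$;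 $g_\Phi(\partial_{x_2},\partial_{x_3})=x_1y_{4,1}$; $g_\Phi(\partial_{x_1},\partial_{x_3})=x_2y_{4,2}$. $\Xi$ is regarded as a function on $\mathbb{R}^{14}$ through the coordinate $x_1$, i.e. its value at $P$ is the displayed expression evaluated at $x_1(P)$. That $\Xi$ is a local isometry invariant means: if $F:U\to\tilde U$ is an isometry between open subsets of two manifolds $\mathcal{M}_\Phi$, $\mathcal{M}_{\tilde\Phi}$ of this family (possibly the same one), then $\Xi_{\tilde\Phi}(F(P))=\Xi_\Phi(P)$ for all $P\in U$. A pseudo-Riemannian manifold is locally homogeneous if for any two points $P,Q$ there is an isometry from a neighbourhood of $P$ to a neighbourhood of $Q$ taking $P$ to $Q$. *)

theory Defs
  imports "HOL-Analysis.Analysis"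
begin


definition real_analytic :: "(real \<Rightarrow> real) \<Rightarrow> bool" where
  "real_analytic f \<longleftrightarrow>
     (\<forall>c. \<exists>a r. r > 0 \<and> (\<forall>x. \<bar>x - c\<bar> < r \<longrightarrow> (\<lambda>n. a n * (x - c) ^ n) sums f x))"

text \<open>Only meaningful for open \<open>U\<close>: the derivative is the full one at each point of \<open>U\<close>,
  and its continuity is expressed direction by direction (equivalent in finite dimension).\<close>

primrec Ck_on :: "nat \<Rightarrow> 'a::euclidean_space set \<Rightarrow> ('a \<Rightarrow> 'b::euclidean_space) \<Rightarrow> bool" where
  "Ck_on 0 U f \<longleftrightarrow> continuous_on U f"
| "Ck_on (Suc k) U f \<longleftrightarrow>
     (\<forall>P\<in>U. f differentiable (at P)) \<and>
     (\<forall>v. Ck_on k U (\<lambda>P. frechet_derivative f (at P) v))"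

definition smooth_map_on :: "'a::euclidean_space set \<Rightarrow> ('a \<Rightarrow> 'b::euclidean_space) \<Rightarrow> bool" where
  "smooth_map_on U f \<longleftrightarrow> (\<forall>k. Ck_on k U f)"

text \<open>A metric on (all of) a Euclidean space, identified with its tangent spaces:
  \<open>g P v w\<close> is the inner product at \<open>P\<close> of the tangent vectors \<open>v\<close> and \<open>w\<close>.\<close>

type_synonym 'a metric_field = "'a \<Rightarrow> 'a \<Rightarrow> 'a \<Rightarrow> real"

definition isometry_between ::
  "'a::euclidean_space metric_field \<Rightarrow> 'a set \<Rightarrow> 'a metric_field \<Rightarrow> 'a set \<Rightarrow> ('a \<Rightarrow> 'a) \<Rightarrow> bool" where
  "isometry_between g U h V F \<longleftrightarrow>
     open U \<and> open V \<and> bij_betw F U V \<and>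
     smooth_map_on U F \<and> smooth_map_on V (inv_into U F) \<and>
     (\<forall>P\<in>U. \<forall>v w.
        h (F P) (frechet_derivative F (at P) v) (frechet_derivative F (at P) w) = g P v w)"

definition locally_homogeneous :: "'a::euclidean_space metric_field \<Rightarrow> bool" where
  "locally_homogeneous g \<longleftrightarrow>
     (\<forall>P Q. \<exists>U V F. P \<in> U \<and> Q \<in> V \<and> isometry_between g U g V F \<and> F P = Q)"

definition locally_constant :: "('a::topological_space \<Rightarrow> 'b) \<Rightarrow> bool" where
  "locally_constant f \<longleftrightarrow> (\<forall>P. \<exists>U. open U \<and> P \<in> U \<and> (\<forall>Q\<in>U. f Q = f P))"



text \<open>Labels of the 14 coordinates: \<open>Xi\<close> is \<open>x\<^sub>i\<close>, \<open>XSi\<close> is the starred \<open>x\<^sub>i\<close>, and \<open>Yij\<close> is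
  \<open>y\<^sub>i\<^sub>,\<^sub>j\<close>.  The coordinate vector field of the coordinate \<open>c\<close> is \<open>axis c 1\<close>.\<close>

datatype coord =
  X1 | X2 | X3 | XS1 | XS2 | XS3 | Y11 | Y12 | Y21 | Y22 | Y31 | Y32 | Y41 | Y42

lemma UNIV_coord:
  "(UNIV :: coord set) = {X1, X2, X3, XS1, XS2, XS3, Y11, Y12, Y21, Y22, Y31, Y32, Y41, Y42}"
  using coord.exhaust by auto

instance coord :: finite
  by standard (simp add: UNIV_coord)

lemma card_coord: "CARD(coord) = 14"
  by (simp add: UNIV_coord)

type_synonym R14 = "real ^ coord"

text \<open>The symmetric bilinear form whose components at \<open>(i, j)\<close> and \<open>(j, i)\<close> are 1 (\<open>i = j\<close>
  allowed), all others being 0.\<close>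

definition sym_form :: "coord \<Rightarrow> coord \<Rightarrow> R14 \<Rightarrow> R14 \<Rightarrow> real" where
  "sym_form i j v w = (if i = j then v $ i * w $ i else v $ i * w $ j + v $ j * w $ i)"

definition g_Phi :: "(real \<Rightarrow> real) \<Rightarrow> (real \<Rightarrow> real) \<Rightarrow> R14 metric_field" where
  "g_Phi \<phi>11 \<phi>12 P v w =
     sym_form X1 XS1 v w + sym_form X2 XS2 v w + sym_form X3 XS3 v w
   + sym_form Y11 Y12 v w + sym_form Y21 Y22 v w + sym_form Y31 Y32 v w
   + (- 1/2) * sym_form Y41 Y41 v w + (- 1/2) * sym_form Y42 Y42 v w
   + (1/4) * sym_form Y41 Y42 v w
   + (- 2 * P $ X2 * P $ Y21 - 2 * P $ X3 * P $ Y31) * sym_form X1 X1 v w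
   + (- 2 * P $ X3 * P $ Y32 - 2 * \<phi>12 (P $ X1) * P $ Y12) * sym_form X2 X2 v w
   + (- 2 * \<phi>11 (P $ X1) * P $ Y11 - 2 * P $ X2 * P $ Y22) * sym_form X3 X3 v w
   + P $ X1 * P $ Y41 * sym_form X2 X3 v w
   + P $ X2 * P $ Y42 * sym_form X1 X3 v w"

lemma g_Phi_sym: "g_Phi \<phi>11 \<phi>12 P v w = g_Phi \<phi>11 \<phi>12 P w v"
  by (simp add: g_Phi_def sym_form_def algebra_simps)

lemma g_Phi_bilinear: "bilinear (g_Phi \<phi>11 \<phi>12 P)"
  by (auto simp: bilinear_def g_Phi_def sym_form_def algebra_simps add_divide_distrib intro!: linearI)

lemma g_Phi_nondegenerate:
  assumes "\<And>w. g_Phi \<phi>11 \<phi>12 P v w = 0"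
  shows "v = 0"
proof -
  have X: "v $ X1 = 0" "v $ X2 = 0" "v $ X3 = 0"
    using assms[of "axis XS1 1"] assms[of "axis XS2 1"] assms[of "axis XS3 1"]
    by (simp_all add: g_Phi_def sym_form_def axis_def)
  have Y: "v $ Y11 = 0" "v $ Y12 = 0" "v $ Y21 = 0" "v $ Y22 = 0" "v $ Y31 = 0" "v $ Y32 = 0"
    using assms[of "axis Y12 1"] assms[of "axis Y11 1"] assms[of "axis Y22 1"]
      assms[of "axis Y21 1"] assms[of "axis Y32 1"] assms[of "axis Y31 1"]
    by (simp_all add: g_Phi_def sym_form_def axis_def)
  have Y4: "v $ Y41 = 0" "v $ Y42 = 0"
    using assms[of "axis Y41 1"] assms[of "axis Y42 1"]
    by (simp_all add: g_Phi_def sym_form_def axis_def)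
  have XS: "v $ XS1 = 0" "v $ XS2 = 0" "v $ XS3 = 0"
    using assms[of "axis X1 1"] assms[of "axis X2 1"] assms[of "axis X3 1"] X
    by (simp_all add: g_Phi_def sym_form_def axis_def)
  have "v $ c = 0" for c
    by (cases c) (simp_all add: X Y Y4 XS)
  then show ?thesis
    by (simp add: vec_eq_iff)
qed

definition admissible :: "(real \<Rightarrow> real) \<Rightarrow> (real \<Rightarrow> real) \<Rightarrow> bool" where
  "admissible \<phi>11 \<phi>12 \<longleftrightarrow>
     real_analytic \<phi>11 \<and> real_analytic \<phi>12 \<and>
     (\<forall>t. deriv \<phi>11 t * deriv \<phi>12 t = 1) \<and>
     (\<forall>t. (deriv ^^ 2) \<phi>11 t \<noteq> 0) \<and> (\<forall>t. (deriv ^^ 2) \<phi>12 t \<noteq> 0)"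

definition Xi :: "(real \<Rightarrow> real) \<Rightarrow> R14 \<Rightarrow> real" where
  "Xi \<phi>11 P =
     (1 - deriv \<phi>11 (P $ X1) * (deriv ^^ 3) \<phi>11 (P $ X1) / ((deriv ^^ 2) \<phi>11 (P $ X1))\<^sup>2)\<^sup>2"

end

theory Submission
  imports Defs
begin

text \<open>Let \<open>F\<close> be an isometry with differential \<open>J\<close>. The vectors on which all curvature components
  \<open>R(_, _, _, k)\<close> vanish are exactly the combinations of the \<open>\<partial>x\<^sub>i\<^sup>*\<close>, so \<open>J\<close> preserves this space and its
  orthogonal complement, spanned by the \<open>\<partial>x\<^sub>i\<^sup>*\<close> and the \<open>\<partial>y\<close>. As \<open>F\<close> preserves the Christoffel
  symbols, whose \<open>x\<close>-components vanish, the \<open>x\<close>-components of \<open>D\<^sup>2F\<close> vanish, and so do the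
  \<open>y\<close>-components of \<open>D\<^sup>2F(z, y)\<close>.

  For \<open>y\<close> in the complement, \<open>R(w, u, v, y)\<close> only involves \<open>x\<^sub>1\<close>, the \<open>x\<close>-components of
  \<open>w, u, v\<close> and the \<open>y\<close>-components of \<open>y\<close>. Differentiating its invariance therefore yields the
  invariance of the \<open>x\<^sub>1\<close>-derivative alone, without correction terms. Comparing the two gives
  \<open>dF\<^sub>1 = a dx\<^sub>1\<close> with \<open>Da = 0\<close> and \<open>a \<psi>'' / \<psi>' = \<plusminus> \<phi>'' / \<phi>'\<close>; squaring and differentiating
  once more in \<open>x\<^sub>1\<close> gives the invariance of \<open>\<Xi> = ((\<phi>' / \<phi>'')')\<^sup>2\<close>.

  If \<open>\<Xi>\<close> is locally constant, then \<open>\<phi>' / \<phi>''\<close> is affine and has no zero on the real line, hence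
  is constant, and \<open>\<phi>'\<close> is an exponential.\<close>

subsection \<open>Analytic functions and symmetric second derivatives\<close>

text \<open>Termwise differentiation of the local power series. One radius serves both conclusions,
  so that differentiability and analyticity of the derivative can each be read off.\<close>

lemma real_analytic_has_deriv_series:
  assumes "real_analytic f"
  shows "\<exists>a r. r > 0 \<and> (\<forall>x. \<bar>x - c\<bar> < r \<longrightarrow>
     (f has_real_derivative deriv f x) (at x) \<and> (\<lambda>n. a n * (x - c) ^ n) sums deriv f x)"
proof -
  obtain a r where r: "r > 0" and s: "\<And>x. \<bar>x - c\<bar> < r \<Longrightarrow> (\<lambda>n. a n * (x - c) ^ n) sums f x"
    using assms unfolding real_analytic_def by blast
  define S where "S z = (\<Sum>n. a n * z ^ n)" for z
  have sm: "summable (\<lambda>n. a n * z ^ n)" if "norm z < r" for z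
    using s[of "z + c"] that by (auto simp: sums_iff)
  have S: "(S has_real_derivative (\<Sum>n. diffs a n * z ^ n)) (at z)" if "norm z < r" for z
    unfolding S_def by (rule termdiffs_strong'[of r]) (use sm that in auto)
  have f: "(f has_real_derivative (\<Sum>n. diffs a n * (x - c) ^ n)) (at x)" if x: "\<bar>x - c\<bar> < r" for x
  proof -
    have "((\<lambda>x. S (x - c)) has_real_derivative (\<Sum>n. diffs a n * (x - c) ^ n)) (at x)"
      using DERIV_shift[of S _ x "- c"] S[of "x - c"] x by simp
    then show ?thesis
    proof (rule has_field_derivative_transform_within_open)
      show "open {x. \<bar>x - c\<bar> < r}" by (intro open_Collect_less continuous_intros)
      show "x \<in> {x. \<bar>x - c\<bar> < r}" using x by simp
      show "S (y - c) = f y" if "y \<in> {x. \<bar>x - c\<bar> < r}" for y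
        using s[of y] that by (simp add: S_def sums_iff)
    qed
  qed
  have "(\<lambda>n. diffs a n * (x - c) ^ n) sums deriv f x" if "\<bar>x - c\<bar> < r" for x
    using termdiff_converges[of "x - c" r a] sm that DERIV_imp_deriv[OF f[OF that]]
    by (simp add: sums_iff)
  moreover have "(f has_real_derivative deriv f x) (at x)" if "\<bar>x - c\<bar> < r" for x
    using f[OF that] DERIV_imp_deriv by metis
  ultimately show ?thesis
    using r by blast
qed

lemma real_analytic_deriv: "real_analytic f \<Longrightarrow> real_analytic (deriv f)"
  using real_analytic_has_deriv_series unfolding real_analytic_def by blast

lemma real_analytic_DERIV:
  assumes "real_analytic f"
  shows "(f has_real_derivative deriv f x) (at x)"
  using real_analytic_has_deriv_series[OF assms, of x] by auto

text \<open>The mean value theorem along \<open>u\<close> turns the mixed second difference into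
  \<open>h\<close> times a difference of values of \<open>f' _ u\<close>, which the derivative
  \<open>L\<close> at the single point \<open>p\<close> approximates.\<close>

lemma second_difference_approx:
  fixes f :: "'a::real_normed_vector \<Rightarrow> real"
  assumes U: "open U" "p \<in> U"
    and f: "\<And>x. x \<in> U \<Longrightarrow> (f has_derivative f' x) (at x)"
    and L: "((\<lambda>x. f' x u) has_derivative L) (at p)"
    and e: "e > 0"
  shows "\<exists>d>0. \<forall>h. 0 < h \<and> h < d \<longrightarrow>
    \<bar>f (p + h *\<^sub>R u + h *\<^sub>R v) - f (p + h *\<^sub>R u) - f (p + h *\<^sub>R v) + f p - h\<^sup>2 * L v\<bar> \<le> e * h\<^sup>2"
proof -
  \<comment> \<open>The points of the parallelogram used below lie within \<open>h * M\<close> of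
    \<open>p\<close>. The summand 1 keeps \<open>M\<close> positive when \<open>u\<close> and
    \<open>v\<close> vanish.\<close>
  define M where "M = 2 * (norm u + norm v) + 1"
  have M: "M > 0" "norm u + norm v < M" unfolding M_def by (auto simp: add_nonneg_pos)
  obtain r where r: "r > 0" "ball p r \<subseteq> U" using U open_contains_ball by blast
  have "e / (2 * M) > 0" using e M by simp
  then obtain d0 where d0: "d0 > 0"
    "\<And>y. norm (y - p) < d0 \<Longrightarrow> norm (f' y u - f' p u - L (y - p)) \<le> e / (2 * M) * norm (y - p)"
    using L[unfolded has_derivative_at_alt] by blast
  have lin: "linear L" using L has_derivative_linear by blast
  define d where "d = min r d0 / M"
  have "d > 0" using r d0 M by (simp add: d_def)
  moreover have "\<bar>f (p + h *\<^sub>R u + h *\<^sub>R v) - f (p + h *\<^sub>R u) - f (p + h *\<^sub>R v) + f p - h\<^sup>2 * L v\<bar> \<le> e * h\<^sup>2"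
    if h: "0 < h" "h < d" for h
  proof -
    have hM: "h * M < r" "h * M < d0" using h M by (simp_all add: d_def pos_less_divide_eq)
    have small: "norm (s *\<^sub>R u + t *\<^sub>R v) \<le> h * M" if "0 \<le> s" "s \<le> h" "0 \<le> t" "t \<le> h" for s t
    proof -
      have "norm (s *\<^sub>R u + t *\<^sub>R v) \<le> s * norm u + t * norm v"
        using norm_triangle_ineq[of "s *\<^sub>R u" "t *\<^sub>R v"] that by simp
      also have "\<dots> \<le> h * norm u + h * norm v" using that by (intro add_mono mult_right_mono) auto
      also have "\<dots> \<le> h * M" using M h by (simp flip: distrib_left)
      finally show ?thesis .
    qed
    have inU: "p + (s *\<^sub>R u + t *\<^sub>R v) \<in> U" if "0 \<le> s" "s \<le> h" "0 \<le> t" "t \<le> h" for s t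
    proof (rule subsetD[OF r(2)])
      have "dist p (p + (s *\<^sub>R u + t *\<^sub>R v)) = norm (s *\<^sub>R u + t *\<^sub>R v)"
        by (metis add_diff_cancel_left' dist_commute dist_norm)
      then show "p + (s *\<^sub>R u + t *\<^sub>R v) \<in> ball p r" using small[OF that] hM by simp
    qed
    have D: "((\<lambda>s. f (p + (s *\<^sub>R u + t *\<^sub>R v))) has_real_derivative f' (p + (s *\<^sub>R u + t *\<^sub>R v)) u) (at s)"
      if "0 \<le> s" "s \<le> h" "0 \<le> t" "t \<le> h" for s t
    proof -
      have "((\<lambda>s. p + (s *\<^sub>R u + t *\<^sub>R v)) has_derivative (\<lambda>k. k *\<^sub>R u)) (at s)"
        by (auto intro!: derivative_eq_intros)
      from diff_chain_at[OF this f[OF inU[OF that]]]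
      have "((\<lambda>s. f (p + (s *\<^sub>R u + t *\<^sub>R v))) has_derivative (\<lambda>k. f' (p + (s *\<^sub>R u + t *\<^sub>R v)) (k *\<^sub>R u))) (at s)"
        by (simp add: o_def)
      moreover have "linear (f' (p + (s *\<^sub>R u + t *\<^sub>R v)))"
        using f[OF inU[OF that]] has_derivative_linear by blast
      ultimately show ?thesis
        by (simp add: has_field_derivative_def linear_cmul mult.commute[of _ "f' _ u"])
    qed
    \<comment> \<open>\<open>G h - G 0\<close> is the second difference.\<close>
    define G where "G s = f (p + (s *\<^sub>R u + h *\<^sub>R v)) - f (p + (s *\<^sub>R u + 0 *\<^sub>R v))" for s
    have "\<exists>z. 0 < z \<and> z < h \<and> G h - G 0 = (h - 0) *
       (f' (p + (z *\<^sub>R u + h *\<^sub>R v)) u - f' (p + (z *\<^sub>R u + 0 *\<^sub>R v)) u)"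
      by (rule MVT2) (use h in \<open>auto simp: G_def intro!: DERIV_diff D[of _ h] D[of _ 0, simplified]\<close>)
    then obtain z where z: "0 < z" "z < h" and
      Gz: "G h - G 0 = h * (f' (p + (z *\<^sub>R u + h *\<^sub>R v)) u - f' (p + z *\<^sub>R u) u)" by auto
    \<comment> \<open>\<open>A\<close> and \<open>B\<close> are the linearisation errors at the two
      points; in \<open>A - B\<close> the multiples of \<open>L u\<close> cancel and only
      \<open>h * L v\<close> is subtracted.\<close>
    define A where "A = f' (p + (z *\<^sub>R u + h *\<^sub>R v)) u - f' p u - L (z *\<^sub>R u + h *\<^sub>R v)"
    define B where "B = f' (p + z *\<^sub>R u) u - f' p u - L (z *\<^sub>R u)"
    have bound: "norm (f' (p + x) u - f' p u - L x) \<le> e / 2 * h" if "norm x \<le> h * M" for x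
    proof -
      have "norm (f' (p + x) u - f' p u - L x) \<le> e / (2 * M) * norm x"
        using d0(2)[of "p + x"] that hM by simp
      also have "\<dots> \<le> e / (2 * M) * (h * M)" using that e M by (intro mult_left_mono) auto
      finally show ?thesis using M by simp
    qed
    have "\<bar>A\<bar> \<le> e / 2 * h" unfolding A_def using bound[OF small[of z h]] z h by simp
    moreover have "\<bar>B\<bar> \<le> e / 2 * h" unfolding B_def using bound[OF small[of z 0]] z h by simp
    moreover have AB: "G h - G 0 - h\<^sup>2 * L v = h * (A - B)"
      unfolding Gz A_def B_def
      by (simp add: linear_add[OF lin] linear_cmul[OF lin] algebra_simps power2_eq_square)
    ultimately have "\<bar>G h - G 0 - h\<^sup>2 * L v\<bar> \<le> h * (e * h)"
      unfolding AB abs_mult using h by (intro mult_mono) auto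
    then show ?thesis by (simp add: G_def algebra_simps power2_eq_square)
  qed
  ultimately show ?thesis by blast
qed

text \<open>The second difference is unchanged when \<open>u\<close> and \<open>v\<close> are
  swapped, so divided by the square of \<open>h\<close> it tends to both values. Inner products with
  basis vectors reduce the claim to real functions.\<close>

lemma second_derivative_symmetric:
  fixes f :: "'a::real_normed_vector \<Rightarrow> 'b::euclidean_space"
  assumes U: "open U" "p \<in> U"
    and f: "\<And>x. x \<in> U \<Longrightarrow> (f has_derivative f' x) (at x)"
    and u: "((\<lambda>x. f' x u) has_derivative Lu) (at p)"
    and v: "((\<lambda>x. f' x v) has_derivative Lv) (at p)"
  shows "Lu v = Lv u"
proof (rule euclidean_eqI)
  fix b :: 'b assume "b \<in> Basis"
  have fb: "((\<lambda>x. f x \<bullet> b) has_derivative (\<lambda>w. f' x w \<bullet> b)) (at x)" if "x \<in> U" for x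
    using f[OF that] by (rule has_derivative_inner_left)
  have "\<bar>Lu v \<bullet> b - Lv u \<bullet> b\<bar> \<le> e" if e: "e > 0" for e :: real
  proof -
    define D where "D h = f (p + h *\<^sub>R u + h *\<^sub>R v) \<bullet> b - f (p + h *\<^sub>R u) \<bullet> b
      - f (p + h *\<^sub>R v) \<bullet> b + f p \<bullet> b" for h
    have D': "D h = f (p + h *\<^sub>R v + h *\<^sub>R u) \<bullet> b - f (p + h *\<^sub>R v) \<bullet> b
      - f (p + h *\<^sub>R u) \<bullet> b + f p \<bullet> b" for h
      by (simp add: D_def add.assoc add.commute[of "h *\<^sub>R u" "h *\<^sub>R v"])
    obtain d1 where d1: "d1 > 0" "\<And>h. 0 < h \<and> h < d1 \<Longrightarrow> \<bar>D h - h\<^sup>2 * (Lu v \<bullet> b)\<bar> \<le> e / 2 * h\<^sup>2"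
      using second_difference_approx[OF U fb has_derivative_inner_left[OF u] half_gt_zero[OF e], of v]
      unfolding D_def by blast
    obtain d2 where d2: "d2 > 0" "\<And>h. 0 < h \<and> h < d2 \<Longrightarrow> \<bar>D h - h\<^sup>2 * (Lv u \<bullet> b)\<bar> \<le> e / 2 * h\<^sup>2"
      using second_difference_approx[OF U fb has_derivative_inner_left[OF v] half_gt_zero[OF e], of u]
      unfolding D' by blast
    obtain h where h: "0 < h" "h < d1" "h < d2"
      using d1(1) d2(1) field_lbound_gt_zero by blast
    have "\<bar>h\<^sup>2 * (Lu v \<bullet> b) - h\<^sup>2 * (Lv u \<bullet> b)\<bar> \<le> e * h\<^sup>2"
      using d1(2)[of h] d2(2)[of h] h by linarith
    then have "h\<^sup>2 * \<bar>Lu v \<bullet> b - Lv u \<bullet> b\<bar> \<le> h\<^sup>2 * e"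
      by (simp add: abs_mult mult.commute[of e] flip: right_diff_distrib)
    then show ?thesis using h by simp
  qed
  then show "Lu v \<bullet> b = Lv u \<bullet> b"
    using field_le_epsilon[of "\<bar>Lu v \<bullet> b - Lv u \<bullet> b\<bar>" 0] by auto
qed

section \<open>Product rules for bilinear and linear maps that depend on the point\<close>

lemma has_derivative_bilinear_field:
  fixes B :: "'p::real_normed_vector \<Rightarrow> 'a::euclidean_space \<Rightarrow> 'a \<Rightarrow> 'b::real_normed_vector"
  assumes B: "\<And>q. bilinear (B q)"
    and dB: "\<And>v w. ((\<lambda>q. B q v w) has_derivative (\<lambda>h. dB h v w)) (at (f x))"
    and f: "(f has_derivative f') (at x)"
    and a: "(a has_derivative a') (at x)" and b: "(b has_derivative b') (at x)"
  shows "((\<lambda>x. B (f x) (a x) (b x)) has_derivative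
    (\<lambda>h. dB (f' h) (a x) (b x) + B (f x) (a' h) (b x) + B (f x) (a x) (b' h))) (at x)"
proof -
  \<comment> \<open>In the basis expansion only scalar coordinates and the values
    \<open>B q i j\<close> at fixed \<open>i\<close>, \<open>j\<close> depend on the point, and the
    derivatives of all of these are known.\<close>
  have expand: "B q v w = (\<Sum>i\<in>Basis. \<Sum>j\<in>Basis. (v \<bullet> i) *\<^sub>R (w \<bullet> j) *\<^sub>R B q i j)" for q v w
  proof -
    have "B q v w = B q (\<Sum>i\<in>Basis. (v \<bullet> i) *\<^sub>R i) (\<Sum>j\<in>Basis. (w \<bullet> j) *\<^sub>R j)"
      by (simp add: euclidean_representation)
    also have "\<dots> = (\<Sum>(i,j)\<in>Basis \<times> Basis. B q ((v \<bullet> i) *\<^sub>R i) ((w \<bullet> j) *\<^sub>R j))"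
      by (rule bilinear_sum[OF B])
    finally show ?thesis
      by (simp add: sum.cartesian_product bilinear_lmul[OF B] bilinear_rmul[OF B] mult.commute)
  qed
  \<comment> \<open>Bilinearity of \<open>dB h\<close> comes from differentiating the expansion and
    uniqueness of derivatives.\<close>
  have dexpand: "dB h v w = (\<Sum>i\<in>Basis. \<Sum>j\<in>Basis. (v \<bullet> i) *\<^sub>R (w \<bullet> j) *\<^sub>R dB h i j)" for h v w
  proof -
    have "((\<lambda>q. B q v w) has_derivative (\<lambda>h. \<Sum>i\<in>Basis. \<Sum>j\<in>Basis. (v \<bullet> i) *\<^sub>R (w \<bullet> j) *\<^sub>R dB h i j)) (at (f x))"
      unfolding expand[of _ v w] by (intro has_derivative_sum has_derivative_scaleR_right dB)
    from has_derivative_unique[OF this dB] show ?thesis by (rule fun_cong[symmetric])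
  qed
  have c: "((\<lambda>x. B (f x) i j) has_derivative (\<lambda>h. dB (f' h) i j)) (at x)" for i j
    using diff_chain_at[OF f dB] by (simp add: o_def)
  have "((\<lambda>x. \<Sum>i\<in>Basis. \<Sum>j\<in>Basis. (a x \<bullet> i) *\<^sub>R (b x \<bullet> j) *\<^sub>R B (f x) i j) has_derivative
     (\<lambda>h. \<Sum>i\<in>Basis. \<Sum>j\<in>Basis. (a x \<bullet> i) *\<^sub>R ((b x \<bullet> j) *\<^sub>R dB (f' h) i j + (b' h \<bullet> j) *\<^sub>R B (f x) i j)
        + (a' h \<bullet> i) *\<^sub>R (b x \<bullet> j) *\<^sub>R B (f x) i j)) (at x)"
    by (intro has_derivative_sum has_derivative_scaleR has_derivative_inner_left a b c)
  moreover have "(\<lambda>h. dB (f' h) (a x) (b x) + B (f x) (a' h) (b x) + B (f x) (a x) (b' h)) =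
     (\<lambda>h. \<Sum>i\<in>Basis. \<Sum>j\<in>Basis. (a x \<bullet> i) *\<^sub>R ((b x \<bullet> j) *\<^sub>R dB (f' h) i j + (b' h \<bullet> j) *\<^sub>R B (f x) i j)
        + (a' h \<bullet> i) *\<^sub>R (b x \<bullet> j) *\<^sub>R B (f x) i j)"
    unfolding dexpand[of _ "a x" "b x"] expand[of _ _ "b x"] expand[of _ "a x"]
    by (simp add: sum.distrib scaleR_add_right ac_simps)
  ultimately show ?thesis
    unfolding expand[of _ "a _" "b _"] by simp
qed

text \<open>Linearity is asked for only on an open set around \<open>p\<close>, because the
  differential of an isometry is controlled only on its domain.\<close>

lemma has_derivative_linear_field:
  fixes B :: "'p::real_normed_vector \<Rightarrow> 'a::euclidean_space \<Rightarrow> 'b::real_normed_vector"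
  assumes S: "open S" "p \<in> S" and B: "\<And>q. q \<in> S \<Longrightarrow> linear (B q)"
    and dB: "\<And>v. ((\<lambda>q. B q v) has_derivative (\<lambda>h. dB h v)) (at p)"
    and a: "(a has_derivative a') (at p)"
  shows "((\<lambda>q. B q (a q)) has_derivative (\<lambda>h. dB h (a p) + B p (a' h))) (at p)"
proof -
  have expand: "(\<Sum>i\<in>Basis. (v \<bullet> i) *\<^sub>R B q i) = B q v" if "q \<in> S" for q v
    using linear_sum[OF B[OF that], of "\<lambda>i. (v \<bullet> i) *\<^sub>R i" Basis]
    by (simp add: euclidean_representation linear_cmul[OF B[OF that]])
  have dexpand: "(\<Sum>i\<in>Basis. (v \<bullet> i) *\<^sub>R dB h i) = dB h v" for h v
  proof -
    have "((\<lambda>q. \<Sum>i\<in>Basis. (v \<bullet> i) *\<^sub>R B q i) has_derivative (\<lambda>h. \<Sum>i\<in>Basis. (v \<bullet> i) *\<^sub>R dB h i)) (at p)"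
      by (intro has_derivative_sum has_derivative_scaleR_right dB)
    from has_derivative_transform_within_open[OF this S expand]
    have "((\<lambda>q. B q v) has_derivative (\<lambda>h. \<Sum>i\<in>Basis. (v \<bullet> i) *\<^sub>R dB h i)) (at p)" .
    from has_derivative_unique[OF this dB] show ?thesis by (rule fun_cong)
  qed
  have "((\<lambda>q. \<Sum>i\<in>Basis. (a q \<bullet> i) *\<^sub>R B q i) has_derivative
     (\<lambda>h. \<Sum>i\<in>Basis. (a p \<bullet> i) *\<^sub>R dB h i + (a' h \<bullet> i) *\<^sub>R B p i)) (at p)"
    by (intro has_derivative_sum has_derivative_scaleR has_derivative_inner_left a dB)
  also have "(\<lambda>h. \<Sum>i\<in>Basis. (a p \<bullet> i) *\<^sub>R dB h i + (a' h \<bullet> i) *\<^sub>R B p i) = (\<lambda>h. dB h (a p) + B p (a' h))"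
    by (simp add: sum.distrib expand[OF S(2)] dexpand)
  finally show ?thesis
    by (rule has_derivative_transform_within_open[OF _ S expand])
qed

subsection \<open>Curvature and isometries\<close>

text \<open>The coordinate expression of R(w, u) v for constant vector fields, whose brackets
  vanish. The first vector argument of \<open>d\<Gamma>\<close> is the direction of
  differentiation.\<close>

definition curvature ::
  "('a \<Rightarrow> 'a \<Rightarrow> 'a \<Rightarrow> 'a) \<Rightarrow> ('a \<Rightarrow> 'a \<Rightarrow> 'a \<Rightarrow> 'a \<Rightarrow> 'a) \<Rightarrow> 'a \<Rightarrow> 'a \<Rightarrow> 'a \<Rightarrow> 'a::euclidean_space \<Rightarrow> 'a" where
  "curvature \<Gamma> d\<Gamma> P w u v = d\<Gamma> P w u v - d\<Gamma> P u w v + \<Gamma> P w (\<Gamma> P u v) - \<Gamma> P u (\<Gamma> P w v)"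

text \<open>The Christoffel symbols are characterised by the Koszul identity for constant fields
  instead of the inverse metric, so that an explicit table can be checked against it.\<close>

locale levi_civita =
  fixes g :: "'a::euclidean_space metric_field"
    and dg :: "'a \<Rightarrow> 'a \<Rightarrow> 'a \<Rightarrow> 'a \<Rightarrow> real"
    and \<Gamma> :: "'a \<Rightarrow> 'a \<Rightarrow> 'a \<Rightarrow> 'a"
    and d\<Gamma> :: "'a \<Rightarrow> 'a \<Rightarrow> 'a \<Rightarrow> 'a \<Rightarrow> 'a"
  assumes bilinear_metric: "bilinear (g P)"
    and metric_sym: "g P v w = g P w v"
    and metric_nondegenerate: "(\<And>w. g P v w = 0) \<Longrightarrow> v = 0"
    and metric_has_derivative: "((\<lambda>P. g P v w) has_derivative (\<lambda>u. dg P u v w)) (at P)"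
    and koszul: "2 * g P (\<Gamma> P u v) w = dg P u v w + dg P v u w - dg P w u v"
    and bilinear_christoffel: "bilinear (\<Gamma> P)"
    and christoffel_has_derivative: "((\<lambda>P. \<Gamma> P u v) has_derivative (\<lambda>w. d\<Gamma> P w u v)) (at P)"

locale local_isometry =
  g: levi_civita g dg \<Gamma> d\<Gamma> + h: levi_civita h dh \<Delta> d\<Delta>
  for g :: "'a::euclidean_space metric_field" and dg \<Gamma> d\<Gamma> and h :: "'a metric_field" and dh \<Delta> d\<Delta> +
  fixes U :: "'a set" and F :: "'a \<Rightarrow> 'a"
  assumes open_dom: "open U"
    and smooth: "smooth_map_on U F"
    and isometric: "P \<in> U \<Longrightarrow>
      h (F P) (frechet_derivative F (at P) v) (frechet_derivative F (at P) w) = g P v w"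
begin

text \<open>The direction differentiated last comes first: \<open>D2 P u v\<close> is the derivative
  of \<open>J _ v\<close> along \<open>u\<close>.\<close>

definition J where "J P v = frechet_derivative F (at P) v"
definition D2 where "D2 P u v = frechet_derivative (\<lambda>Q. J Q v) (at P) u"
definition D3 where "D3 P w u v = frechet_derivative (\<lambda>Q. D2 Q u v) (at P) w"

lemma pullback: "P \<in> U \<Longrightarrow> h (F P) (J P v) (J P w) = g P v w"
  using isometric by (simp add: J_def)

lemma
  assumes "P \<in> U"
  shows F_has_derivative: "(F has_derivative J P) (at P)"
    and J_has_derivative: "((\<lambda>Q. J Q v) has_derivative (\<lambda>u. D2 P u v)) (at P)"
    and D2_has_derivative: "((\<lambda>Q. D2 Q u v) has_derivative (\<lambda>w. D3 P w u v)) (at P)"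
proof -
  have "Ck_on (Suc (Suc (Suc 0))) U F"
    using smooth unfolding smooth_map_on_def by blast
  then have "F differentiable (at P)" "(\<lambda>Q. J Q v) differentiable (at P)"
    "(\<lambda>Q. D2 Q u v) differentiable (at P)"
    using assms by (auto simp: D2_def[abs_def] J_def[abs_def])
  then show "(F has_derivative J P) (at P)"
    "((\<lambda>Q. J Q v) has_derivative (\<lambda>u. D2 P u v)) (at P)"
    "((\<lambda>Q. D2 Q u v) has_derivative (\<lambda>w. D3 P w u v)) (at P)"
    unfolding frechet_derivative_works D3_def[abs_def] D2_def[abs_def] J_def[abs_def] by auto
qed

lemma linear_J: "P \<in> U \<Longrightarrow> linear (J P)"
  using F_has_derivative has_derivative_linear by blast

lemma D2_sym: "P \<in> U \<Longrightarrow> D2 P u v = D2 P v u"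
  using second_derivative_symmetric[OF open_dom _ F_has_derivative J_has_derivative J_has_derivative]
  by blast

lemma D3_sym: "P \<in> U \<Longrightarrow> D3 P w u v = D3 P u w v"
  using second_derivative_symmetric[OF open_dom _ J_has_derivative D2_has_derivative D2_has_derivative]
  by blast

text \<open>Nondegeneracy of the source metric makes the differential injective, and source and
  target have the same dimension.\<close>

lemma surj_J:
  assumes P: "P \<in> U"
  shows "\<exists>v. J P v = w"
proof -
  have "v = 0" if "J P v = 0" for v
  proof (rule g.metric_nondegenerate)
    show "g P v w = 0" for w
      using pullback[OF P, of v w] that bilinear_lzero[OF h.bilinear_metric] by simp
  qed
  then have "inj (J P)" using linear_J[OF P] by (simp add: linear_injective_0)
  then show ?thesis
    using linear_injective_imp_surjective[OF linear_J[OF P]] by (metis surjD)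
qed

lemma metric_derivative:
  assumes P: "P \<in> U"
  shows "dh (F P) (J P u) (J P v) (J P w) + h (F P) (D2 P u v) (J P w) + h (F P) (J P v) (D2 P u w)
    = dg P u v w"
proof -
  have "((\<lambda>Q. h (F Q) (J Q v) (J Q w)) has_derivative (\<lambda>u. dh (F P) (J P u) (J P v) (J P w)
     + h (F P) (D2 P u v) (J P w) + h (F P) (J P v) (D2 P u w))) (at P)"
    by (rule has_derivative_bilinear_field[OF h.bilinear_metric h.metric_has_derivative
      F_has_derivative[OF P] J_has_derivative[OF P] J_has_derivative[OF P]])
  from has_derivative_unique[OF has_derivative_transform_within_open[OF this open_dom P pullback]
      g.metric_has_derivative]
  show ?thesis by (rule fun_cong)
qed

text \<open>In the Koszul combination of three instances of \<open>metric_derivative\<close>,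
  symmetry of \<open>D2\<close> leaves \<open>D2 P u v\<close> as the only second derivative.
  Nondegeneracy then removes the pairing.\<close>

lemma christoffel_transform:
  assumes P: "P \<in> U"
  shows "D2 P u v + \<Delta> (F P) (J P u) (J P v) = J P (\<Gamma> P u v)"
proof -
  let ?x = "D2 P u v + \<Delta> (F P) (J P u) (J P v) - J P (\<Gamma> P u v)"
  have "h (F P) ?x w = 0" for w
  proof -
    \<comment> \<open>Only test vectors in the image of \<open>J P\<close> can be compared through
      the pullback.\<close>
    obtain z where z: "w = J P z" using surj_J[OF P] by metis
    note [simp] = bilinear_ladd[OF h.bilinear_metric] bilinear_lsub[OF h.bilinear_metric]
    have "2 * h (F P) (D2 P u v) w + 2 * h (F P) (\<Delta> (F P) (J P u) (J P v)) w = 2 * g P (\<Gamma> P u v) z"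
      using metric_derivative[OF P, of u v z] metric_derivative[OF P, of v u z]
        metric_derivative[OF P, of z u v]
      unfolding g.koszul h.koszul z D2_sym[OF P, of z] D2_sym[OF P, of v u]
        h.metric_sym[of _ "D2 P _ _" "J P _"] by simp
    then show ?thesis using pullback[OF P] by (simp add: z)
  qed
  then show ?thesis using h.metric_nondegenerate[of "F P" ?x] by simp
qed

text \<open>The transformation law of the Christoffel symbols is differentiated along
  \<open>w\<close> and antisymmetrised in \<open>w\<close> and \<open>u\<close>, which cancels the
  third derivatives.\<close>

lemma curvature_transform:
  assumes P: "P \<in> U"
  shows "curvature \<Delta> d\<Delta> (F P) (J P w) (J P u) (J P v) = J P (curvature \<Gamma> d\<Gamma> P w u v)"
proof -
  have main: "D3 P w u v + (d\<Delta> (F P) (J P w) (J P u) (J P v) + \<Delta> (F P) (D2 P w u) (J P v)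
      + \<Delta> (F P) (J P u) (D2 P w v)) = D2 P w (\<Gamma> P u v) + J P (d\<Gamma> P w u v)" for w u v
  proof -
    have "((\<lambda>Q. D2 Q u v + \<Delta> (F Q) (J Q u) (J Q v)) has_derivative
      (\<lambda>w. D3 P w u v + (d\<Delta> (F P) (J P w) (J P u) (J P v) + \<Delta> (F P) (D2 P w u) (J P v)
        + \<Delta> (F P) (J P u) (D2 P w v)))) (at P)"
      by (intro has_derivative_add D2_has_derivative[OF P] has_derivative_bilinear_field
        h.bilinear_christoffel h.christoffel_has_derivative
        F_has_derivative[OF P] J_has_derivative[OF P])
    from has_derivative_transform_within_open[OF this open_dom P christoffel_transform]
    have "((\<lambda>Q. J Q (\<Gamma> Q u v)) has_derivative
      (\<lambda>w. D3 P w u v + (d\<Delta> (F P) (J P w) (J P u) (J P v) + \<Delta> (F P) (D2 P w u) (J P v)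
        + \<Delta> (F P) (J P u) (D2 P w v)))) (at P)" by simp
    moreover have "((\<lambda>Q. J Q (\<Gamma> Q u v)) has_derivative
      (\<lambda>w. D2 P w (\<Gamma> P u v) + J P (d\<Gamma> P w u v))) (at P)"
      by (rule has_derivative_linear_field[OF open_dom P linear_J J_has_derivative[OF P]
        g.christoffel_has_derivative])
    ultimately show ?thesis using has_derivative_unique by (metis (no_types, lifting))
  qed
  \<comment> \<open>Used to eliminate all second derivatives except \<open>D2 P w u\<close>; that
    one is symmetric and cancels in the antisymmetrisation.\<close>
  have D2: "D2 P a b = J P (\<Gamma> P a b) - \<Delta> (F P) (J P a) (J P b)" for a b
    using christoffel_transform[OF P, of a b] by (simp add: algebra_simps)
  note lin = linear_add[OF linear_J[OF P]] linear_diff[OF linear_J[OF P]]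
    bilinear_lsub[OF h.bilinear_christoffel] bilinear_rsub[OF h.bilinear_christoffel]
  have "D3 P w u v = J P (\<Gamma> P w (\<Gamma> P u v)) - \<Delta> (F P) (J P w) (J P (\<Gamma> P u v)) + J P (d\<Gamma> P w u v)
     - d\<Delta> (F P) (J P w) (J P u) (J P v) - \<Delta> (F P) (D2 P w u) (J P v)
     - \<Delta> (F P) (J P u) (J P (\<Gamma> P w v)) + \<Delta> (F P) (J P u) (\<Delta> (F P) (J P w) (J P v))" for w u v
    using main[of w u v] unfolding D2[of w "\<Gamma> P u v"] D2[of w v] lin by (simp add: algebra_simps)
  then have "J P (\<Gamma> P w (\<Gamma> P u v)) - \<Delta> (F P) (J P w) (J P (\<Gamma> P u v)) + J P (d\<Gamma> P w u v)
     - d\<Delta> (F P) (J P w) (J P u) (J P v) - \<Delta> (F P) (D2 P w u) (J P v)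
     - \<Delta> (F P) (J P u) (J P (\<Gamma> P w v)) + \<Delta> (F P) (J P u) (\<Delta> (F P) (J P w) (J P v))
   = J P (\<Gamma> P u (\<Gamma> P w v)) - \<Delta> (F P) (J P u) (J P (\<Gamma> P w v)) + J P (d\<Gamma> P u w v)
     - d\<Delta> (F P) (J P u) (J P w) (J P v) - \<Delta> (F P) (D2 P w u) (J P v)
     - \<Delta> (F P) (J P w) (J P (\<Gamma> P u v)) + \<Delta> (F P) (J P w) (\<Delta> (F P) (J P u) (J P v))"
    using D3_sym[OF P, of w u v] D2_sym[OF P, of u w] by metis
  then show ?thesis
    unfolding curvature_def lin by (simp add: algebra_simps)
qed

end

subsection \<open>The metrics \<open>g_Phi\<close>\<close>

definition dg_Phi :: "(real \<Rightarrow> real) \<Rightarrow> (real \<Rightarrow> real) \<Rightarrow> R14 \<Rightarrow> R14 \<Rightarrow> R14 \<Rightarrow> R14 \<Rightarrow> real" where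
  "dg_Phi p q P u v w =
     - 2 * (u $ X2 * P $ Y21 + P $ X2 * u $ Y21 + u $ X3 * P $ Y31 + P $ X3 * u $ Y31) * (v $ X1 * w $ X1)
   - 2 * (u $ X3 * P $ Y32 + P $ X3 * u $ Y32
        + deriv q (P $ X1) * u $ X1 * P $ Y12 + q (P $ X1) * u $ Y12) * (v $ X2 * w $ X2)
   - 2 * (deriv p (P $ X1) * u $ X1 * P $ Y11 + p (P $ X1) * u $ Y11
        + u $ X2 * P $ Y22 + P $ X2 * u $ Y22) * (v $ X3 * w $ X3)
   + (u $ X1 * P $ Y41 + P $ X1 * u $ Y41) * (v $ X2 * w $ X3 + v $ X3 * w $ X2)
   + (u $ X2 * P $ Y42 + P $ X2 * u $ Y42) * (v $ X1 * w $ X3 + v $ X3 * w $ X1)"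

text \<open>The Hessian of the metric coefficients in the directions \<open>z\<close> and
  \<open>u\<close>, hence symmetric in these two.\<close>

definition ddg_Phi :: "(real \<Rightarrow> real) \<Rightarrow> (real \<Rightarrow> real) \<Rightarrow> R14 \<Rightarrow> R14 \<Rightarrow> R14 \<Rightarrow> R14 \<Rightarrow> R14 \<Rightarrow> real" where
  "ddg_Phi p q P z u v w =
     - 2 * (u $ X2 * z $ Y21 + z $ X2 * u $ Y21 + u $ X3 * z $ Y31 + z $ X3 * u $ Y31) * (v $ X1 * w $ X1)
   - 2 * (u $ X3 * z $ Y32 + z $ X3 * u $ Y32
        + deriv (deriv q) (P $ X1) * z $ X1 * u $ X1 * P $ Y12
        + deriv q (P $ X1) * (u $ X1 * z $ Y12 + z $ X1 * u $ Y12)) * (v $ X2 * w $ X2)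
   - 2 * (deriv (deriv p) (P $ X1) * z $ X1 * u $ X1 * P $ Y11
        + deriv p (P $ X1) * (u $ X1 * z $ Y11 + z $ X1 * u $ Y11)
        + u $ X2 * z $ Y22 + z $ X2 * u $ Y22) * (v $ X3 * w $ X3)
   + (u $ X1 * z $ Y41 + z $ X1 * u $ Y41) * (v $ X2 * w $ X3 + v $ X3 * w $ X2)
   + (u $ X2 * z $ Y42 + z $ X2 * u $ Y42) * (v $ X1 * w $ X3 + v $ X3 * w $ X1)"

text \<open>The coefficients of the last two components come from the inverse of the block
  \<open>((-1/2, 1/4), (1/4, -1/2))\<close> of the metric.\<close>

definition christoffel :: "(real \<Rightarrow> real) \<Rightarrow> (real \<Rightarrow> real) \<Rightarrow> R14 \<Rightarrow> R14 \<Rightarrow> R14 \<Rightarrow> R14" where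
  "christoffel p q P u v = (\<chi> c. case c of
      X1 \<Rightarrow> 0 | X2 \<Rightarrow> 0 | X3 \<Rightarrow> 0
    | XS1 \<Rightarrow> (dg_Phi p q P u v (axis X1 1) + dg_Phi p q P v u (axis X1 1) - dg_Phi p q P (axis X1 1) u v) / 2
    | XS2 \<Rightarrow> (dg_Phi p q P u v (axis X2 1) + dg_Phi p q P v u (axis X2 1) - dg_Phi p q P (axis X2 1) u v) / 2
    | XS3 \<Rightarrow> (dg_Phi p q P u v (axis X3 1) + dg_Phi p q P v u (axis X3 1) - dg_Phi p q P (axis X3 1) u v) / 2
    | Y11 \<Rightarrow> q (P $ X1) * (u $ X2 * v $ X2)
    | Y12 \<Rightarrow> p (P $ X1) * (u $ X3 * v $ X3)
    | Y21 \<Rightarrow> P $ X2 * (u $ X3 * v $ X3)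
    | Y22 \<Rightarrow> P $ X2 * (u $ X1 * v $ X1)
    | Y31 \<Rightarrow> P $ X3 * (u $ X2 * v $ X2)
    | Y32 \<Rightarrow> P $ X3 * (u $ X1 * v $ X1)
    | Y41 \<Rightarrow> 4/3 * P $ X1 * (u $ X2 * v $ X3 + u $ X3 * v $ X2)
         + 2/3 * P $ X2 * (u $ X1 * v $ X3 + u $ X3 * v $ X1)
    | Y42 \<Rightarrow> 2/3 * P $ X1 * (u $ X2 * v $ X3 + u $ X3 * v $ X2)
         + 4/3 * P $ X2 * (u $ X1 * v $ X3 + u $ X3 * v $ X1))"

definition dchristoffel :: "(real \<Rightarrow> real) \<Rightarrow> (real \<Rightarrow> real) \<Rightarrow> R14 \<Rightarrow> R14 \<Rightarrow> R14 \<Rightarrow> R14 \<Rightarrow> R14" where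
  "dchristoffel p q P z u v = (\<chi> c. case c of
      X1 \<Rightarrow> 0 | X2 \<Rightarrow> 0 | X3 \<Rightarrow> 0
    | XS1 \<Rightarrow> (ddg_Phi p q P z u v (axis X1 1) + ddg_Phi p q P z v u (axis X1 1) - ddg_Phi p q P z (axis X1 1) u v) / 2
    | XS2 \<Rightarrow> (ddg_Phi p q P z u v (axis X2 1) + ddg_Phi p q P z v u (axis X2 1) - ddg_Phi p q P z (axis X2 1) u v) / 2
    | XS3 \<Rightarrow> (ddg_Phi p q P z u v (axis X3 1) + ddg_Phi p q P z v u (axis X3 1) - ddg_Phi p q P z (axis X3 1) u v) / 2
    | Y11 \<Rightarrow> deriv q (P $ X1) * z $ X1 * (u $ X2 * v $ X2)
    | Y12 \<Rightarrow> deriv p (P $ X1) * z $ X1 * (u $ X3 * v $ X3)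
    | Y21 \<Rightarrow> z $ X2 * (u $ X3 * v $ X3)
    | Y22 \<Rightarrow> z $ X2 * (u $ X1 * v $ X1)
    | Y31 \<Rightarrow> z $ X3 * (u $ X2 * v $ X2)
    | Y32 \<Rightarrow> z $ X3 * (u $ X1 * v $ X1)
    | Y41 \<Rightarrow> 4/3 * z $ X1 * (u $ X2 * v $ X3 + u $ X3 * v $ X2)
         + 2/3 * z $ X2 * (u $ X1 * v $ X3 + u $ X3 * v $ X1)
    | Y42 \<Rightarrow> 2/3 * z $ X1 * (u $ X2 * v $ X3 + u $ X3 * v $ X2)
         + 4/3 * z $ X2 * (u $ X1 * v $ X3 + u $ X3 * v $ X1))"

lemma has_derivative_vec_componentwise:
  fixes f :: "'a::real_normed_vector \<Rightarrow> real ^ 'n"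
  assumes "\<And>i. ((\<lambda>x. f x $ i) has_derivative (\<lambda>h. f' h $ i)) (at x)"
  shows "(f has_derivative f') (at x)"
  using assms by (subst has_derivative_componentwise_within)
    (auto simp: Basis_vec_def inner_axis' inner_axis)

lemma has_derivative_comp_nth:
  fixes P :: "real ^ 'n"
  assumes "(p has_real_derivative p') (at (P $ i))"
  shows "((\<lambda>P. p (P $ i)) has_derivative (\<lambda>u. p' * u $ i)) (at P)"
  using diff_chain_at[OF bounded_linear_imp_has_derivative[OF bounded_linear_vec_nth]
      assms[unfolded has_field_derivative_def]] by (simp add: o_def)

lemma dg_Phi_has_derivative:
  assumes "real_analytic p" "real_analytic q"
  shows "((\<lambda>P. dg_Phi p q P u v w) has_derivative (\<lambda>z. ddg_Phi p q P z u v w)) (at P)"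
proof -
  note [derivative_intros] = bounded_linear_imp_has_derivative[OF bounded_linear_vec_nth]
    has_derivative_comp_nth[OF real_analytic_DERIV]
  note an = assms real_analytic_deriv
  show ?thesis
    unfolding dg_Phi_def ddg_Phi_def
    by (rule derivative_eq_intros refl an | simp add: algebra_simps)+
qed

lemma levi_civita_g_Phi:
  assumes "real_analytic p" "real_analytic q"
  shows "levi_civita (g_Phi p q) (dg_Phi p q) (christoffel p q) (dchristoffel p q)"
proof
  note [derivative_intros] = bounded_linear_imp_has_derivative[OF bounded_linear_vec_nth]
    has_derivative_comp_nth[OF real_analytic_DERIV]
  show "bilinear (g_Phi p q P)" for P by (rule g_Phi_bilinear)
  show "g_Phi p q P v w = g_Phi p q P w v" for P v w by (rule g_Phi_sym)
  show "v = 0" if "\<And>w. g_Phi p q P v w = 0" for P v using that by (rule g_Phi_nondegenerate)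
  show "((\<lambda>P. g_Phi p q P v w) has_derivative (\<lambda>u. dg_Phi p q P u v w)) (at P)" for P v w
    unfolding g_Phi_def dg_Phi_def sym_form_def
    by (rule derivative_eq_intros refl assms | simp add: algebra_simps)+
  show "2 * g_Phi p q P (christoffel p q P u v) w =
    dg_Phi p q P u v w + dg_Phi p q P v u w - dg_Phi p q P w u v" for P u v w
    unfolding g_Phi_def sym_form_def
    by (simp add: christoffel_def dg_Phi_def axis_def) (simp add: field_simps)
  show "bilinear (christoffel p q P)" for P
    unfolding bilinear_def
    by (intro conjI allI linearI; simp add: vec_eq_iff christoffel_def dg_Phi_def algebra_simps
      add_divide_distrib diff_divide_distrib split: coord.split)
  show "((\<lambda>P. christoffel p q P u v) has_derivative (\<lambda>w. dchristoffel p q P w u v)) (at P)" for P u v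
  proof (rule has_derivative_vec_componentwise)
    note [derivative_intros] = dg_Phi_has_derivative[OF assms]
    fix c show "((\<lambda>P. christoffel p q P u v $ c) has_derivative (\<lambda>w. dchristoffel p q P w u v $ c)) (at P)"
      by (cases c; simp add: christoffel_def dchristoffel_def;
          (rule derivative_eq_intros refl assms | simp add: algebra_simps)+)
  qed
qed

section \<open>The curvature of \<open>g_Phi\<close> and the subspaces it determines\<close>

lemma axis_nth_if: "axis i x $ j = (if j = i then x else 0)"
  by (simp add: axis_def)

text \<open>The totally isotropic span of the starred coordinate fields, which
  \<open>star_iff\<close> identifies with the null space of the curvature.\<close>

definition star_space :: "R14 set" where
  "star_space = {v. \<forall>c. c \<notin> {XS1, XS2, XS3} \<longrightarrow> v $ c = 0}"

text \<open>The orthogonal complement of \<open>star_space\<close> for every metric of the family,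
  at every point.\<close>

definition x_free_space :: "R14 set" where
  "x_free_space = {v. v $ X1 = 0 \<and> v $ X2 = 0 \<and> v $ X3 = 0}"

text \<open>The curvature tensor on \<open>w\<close>, \<open>u\<close>, \<open>v\<close> and an
  x-free \<open>y\<close>. The point enters only through its first coordinate \<open>t\<close>, and
  only in the \<open>Y12\<close> and \<open>Y11\<close> terms.\<close>

definition curvature_form :: "(real \<Rightarrow> real) \<Rightarrow> (real \<Rightarrow> real) \<Rightarrow> real \<Rightarrow> R14 \<Rightarrow> R14 \<Rightarrow> R14 \<Rightarrow> R14 \<Rightarrow> real" where
  "curvature_form p q t w u v y =
     deriv q t * (w $ X1 * u $ X2 - u $ X1 * w $ X2) * v $ X2 * y $ Y12
   + deriv p t * (w $ X1 * u $ X3 - u $ X1 * w $ X3) * v $ X3 * y $ Y11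
   + (w $ X2 * u $ X3 - u $ X2 * w $ X3) * v $ X3 * y $ Y22
   + (w $ X2 * u $ X1 - u $ X2 * w $ X1) * v $ X1 * y $ Y21
   + (w $ X3 * u $ X2 - u $ X3 * w $ X2) * v $ X2 * y $ Y32
   + (w $ X3 * u $ X1 - u $ X3 * w $ X1) * v $ X1 * y $ Y31
   - 1/2 * (w $ X1 * (u $ X2 * v $ X3 + u $ X3 * v $ X2)
          - u $ X1 * (w $ X2 * v $ X3 + w $ X3 * v $ X2)) * y $ Y41
   - 1/2 * (w $ X2 * (u $ X1 * v $ X3 + u $ X3 * v $ X1)
          - u $ X2 * (w $ X1 * v $ X3 + w $ X3 * v $ X1)) * y $ Y42"

text \<open>The derivative of \<open>curvature_form\<close> along \<open>z\<close> with the four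
  vectors held fixed.\<close>

definition curvature_form_deriv :: "(real \<Rightarrow> real) \<Rightarrow> (real \<Rightarrow> real) \<Rightarrow> real \<Rightarrow> R14 \<Rightarrow> R14 \<Rightarrow> R14 \<Rightarrow> R14 \<Rightarrow> R14 \<Rightarrow> real" where
  "curvature_form_deriv p q t z w u v y = z $ X1 *
     (deriv (deriv q) t * (w $ X1 * u $ X2 - u $ X1 * w $ X2) * v $ X2 * y $ Y12
    + deriv (deriv p) t * (w $ X1 * u $ X3 - u $ X1 * w $ X3) * v $ X3 * y $ Y11)"

abbreviation riemann :: "(real \<Rightarrow> real) \<Rightarrow> (real \<Rightarrow> real) \<Rightarrow> R14 \<Rightarrow> R14 \<Rightarrow> R14 \<Rightarrow> R14 \<Rightarrow> R14" where
  "riemann p q \<equiv> curvature (christoffel p q) (dchristoffel p q)"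

lemma christoffel_x_free: "christoffel p q P u v \<in> x_free_space"
  by (simp add: christoffel_def x_free_space_def)

text \<open>The y-components of the Christoffel symbols are bilinear in the x-components of the two
  arguments.\<close>

lemma christoffel_star:
  assumes "v \<in> x_free_space"
  shows "christoffel p q P u v \<in> star_space"
proof -
  have "christoffel p q P u v $ c = 0" if "c \<notin> {XS1, XS2, XS3}" for c
    using that assms by (cases c) (simp_all add: christoffel_def x_free_space_def)
  then show ?thesis by (simp add: star_space_def)
qed

lemma riemann_x_free: "riemann p q P w u v \<in> x_free_space"
  by (simp add: curvature_def christoffel_def dchristoffel_def x_free_space_def)

lemma star_subset_x_free: "star_space \<subseteq> x_free_space"
  by (auto simp: star_space_def x_free_space_def)

text \<open>Beyond \<open>christoffel_star\<close>, the starred components vanish too: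
  \<open>dg_Phi\<close> is zero if one of its last two arguments is x-free or its direction lies in
  \<open>star_space\<close>.\<close>

lemma christoffel_eq_0:
  assumes "v \<in> x_free_space" and "u \<in> x_free_space \<or> v \<in> star_space"
  shows "christoffel p q P u v = 0"
proof -
  have "christoffel p q P u v $ c = 0" for c
    using assms
    by (cases c) (auto simp: christoffel_def dg_Phi_def star_space_def x_free_space_def)
  then show ?thesis by (simp add: vec_eq_iff)
qed

text \<open>Both terms quadratic in the Christoffel symbols vanish, so these curvature components
  are linear in the second derivatives of the metric.\<close>

lemma riemann_x_free_left:
  assumes "y \<in> x_free_space"
  shows "riemann p q P y u v = dchristoffel p q P y u v - dchristoffel p q P u y v"
proof -
  have sym: "christoffel p q P y v = christoffel p q P v y"
    by (simp add: christoffel_def dg_Phi_def vec_eq_iff algebra_simps split: coord.split)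
  have "christoffel p q P y v \<in> star_space"
    unfolding sym by (rule christoffel_star[OF assms])
  then have "christoffel p q P u (christoffel p q P y v) = 0"
    using star_subset_x_free by (intro christoffel_eq_0) auto
  moreover have "christoffel p q P y (christoffel p q P u v) = 0"
    using assms christoffel_x_free by (intro christoffel_eq_0) auto
  ultimately show ?thesis by (simp add: curvature_def)
qed

lemma riemann_star:
  assumes "y \<in> x_free_space"
  shows "riemann p q P y u v \<in> star_space"
proof -
  have "riemann p q P y u v $ c = 0" if "c \<notin> {XS1, XS2, XS3}" for c
    using that assms unfolding riemann_x_free_left[OF assms]
    by (cases c) (simp_all add: dchristoffel_def x_free_space_def)
  then show ?thesis by (simp add: star_space_def)
qed

lemma riemann_nth_star:
  assumes "y \<in> x_free_space"
  shows "riemann p q P y u v $ XS1 = (ddg_Phi p q P y v u (axis X1 1) - ddg_Phi p q P y (axis X1 1) u v) / 2"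
    and "riemann p q P y u v $ XS2 = (ddg_Phi p q P y v u (axis X2 1) - ddg_Phi p q P y (axis X2 1) u v) / 2"
    and "riemann p q P y u v $ XS3 = (ddg_Phi p q P y v u (axis X3 1) - ddg_Phi p q P y (axis X3 1) u v) / 2"
proof -
  have "ddg_Phi p q P y u v w = ddg_Phi p q P u y v w" for w
    by (simp add: ddg_Phi_def algebra_simps)
  \<comment> \<open>An x-free vector in a metric slot annihilates the Hessian.\<close>
  moreover have "ddg_Phi p q P u w y v = 0" "ddg_Phi p q P u v y w = 0" for w
    using assms by (simp_all add: ddg_Phi_def x_free_space_def)
  ultimately show
    "riemann p q P y u v $ XS1 = (ddg_Phi p q P y v u (axis X1 1) - ddg_Phi p q P y (axis X1 1) u v) / 2"
    "riemann p q P y u v $ XS2 = (ddg_Phi p q P y v u (axis X2 1) - ddg_Phi p q P y (axis X2 1) u v) / 2"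
    "riemann p q P y u v $ XS3 = (ddg_Phi p q P y v u (axis X3 1) - ddg_Phi p q P y (axis X3 1) u v) / 2"
    unfolding riemann_x_free_left[OF assms]
    by (simp_all add: dchristoffel_def diff_divide_distrib add_divide_distrib)
qed

lemma g_Phi_star:
  assumes "k \<in> star_space"
  shows "g_Phi p q P v k = v $ X1 * k $ XS1 + v $ X2 * k $ XS2 + v $ X3 * k $ XS3"
  using assms by (simp add: star_space_def g_Phi_def sym_form_def)

text \<open>Both arguments of the metric are x-free, so only its constant y-block contributes; the
  y-components of the curvature contain no quadratic Christoffel terms.\<close>

lemma g_Phi_riemann:
  assumes "y \<in> x_free_space"
  shows "g_Phi p q P (riemann p q P w u v) y = curvature_form p q (P $ X1) w u v y"
  using assms
  by (simp add: g_Phi_def sym_form_def curvature_def christoffel_def dchristoffel_def x_free_space_def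
      curvature_form_def) (simp add: field_simps)

lemma x_free_iff:
  "v \<in> x_free_space \<longleftrightarrow> (\<forall>k\<in>star_space. g_Phi p q P v k = 0)"
proof
  assume *: "\<forall>k\<in>star_space. g_Phi p q P v k = 0"
  have "axis XS1 1 \<in> star_space" "axis XS2 1 \<in> star_space" "axis XS3 1 \<in> star_space"
    by (auto simp: star_space_def axis_nth_if)
  then show "v \<in> x_free_space"
    using * g_Phi_star[of _ p q P v] by (fastforce simp: x_free_space_def axis_nth_if)
qed (simp add: g_Phi_star x_free_space_def)

text \<open>A description by metric and curvature alone, hence one that isometries respect. For the
  converse, curvatures in x-free directions first kill the x-components of \<open>k\<close>; then
  \<open>curvature_form\<close> is available for its y-components.\<close>

lemma star_iff:
  assumes "deriv p (P $ X1) \<noteq> 0" "deriv q (P $ X1) \<noteq> 0"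
  shows "k \<in> star_space \<longleftrightarrow> (\<forall>w u v. g_Phi p q P (riemann p q P w u v) k = 0)"
proof
  assume "k \<in> star_space"
  then show "\<forall>w u v. g_Phi p q P (riemann p q P w u v) k = 0"
    using x_free_iff riemann_x_free by blast
next
  assume "\<forall>w u v. g_Phi p q P (riemann p q P w u v) k = 0"
  then have *: "g_Phi p q P (riemann p q P w u v) k = 0" for w u v by blast
  \<comment> \<open>Such curvature vectors lie in \<open>star_space\<close> and therefore pair only
    with the x-components of \<open>k\<close>.\<close>
  have **: "k $ X1 * riemann p q P y u v $ XS1 + k $ X2 * riemann p q P y u v $ XS2
      + k $ X3 * riemann p q P y u v $ XS3 = 0" if "y \<in> x_free_space" for y u v
    using *[of y u v] g_Phi_star[OF riemann_star[OF that], of p q P k] by (simp add: g_Phi_sym)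
  have Y: "axis Y21 1 \<in> x_free_space" "axis Y31 1 \<in> x_free_space"
    by (simp_all add: x_free_space_def axis_nth_if)
  have "k $ X2 = 0"
    using **[OF Y(1), of "axis X1 1" "axis X1 1"]
    by (simp add: riemann_nth_star Y ddg_Phi_def axis_nth_if)
  moreover have "k $ X1 = 0"
    using **[OF Y(1), of "axis X1 1" "axis X2 1"]
    by (simp add: riemann_nth_star Y ddg_Phi_def axis_nth_if)
  moreover have "k $ X3 = 0"
    using **[OF Y(2), of "axis X1 1" "axis X1 1"]
    by (simp add: riemann_nth_star Y ddg_Phi_def axis_nth_if)
  ultimately have X: "k \<in> x_free_space" by (simp add: x_free_space_def)
  have curvature_form: "curvature_form p q (P $ X1) w u v k = 0" for w u v
    using *[of w u v] by (simp add: g_Phi_riemann X)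
  have "k $ Y12 = 0" "k $ Y11 = 0" "k $ Y22 = 0" "k $ Y21 = 0" "k $ Y32 = 0" "k $ Y31 = 0"
    "k $ Y41 = 0"
    using curvature_form[of "axis X1 1" "axis X2 1" "axis X2 1"] curvature_form[of "axis X1 1" "axis X3 1" "axis X3 1"]
      curvature_form[of "axis X2 1" "axis X3 1" "axis X3 1"] curvature_form[of "axis X2 1" "axis X1 1" "axis X1 1"]
      curvature_form[of "axis X3 1" "axis X2 1" "axis X2 1"] curvature_form[of "axis X3 1" "axis X1 1" "axis X1 1"]
      curvature_form[of "axis X1 1" "axis X3 1" "axis X2 1"] assms
    by (simp_all add: curvature_form_def axis_nth_if)
  \<comment> \<open>This component mixes \<open>Y41\<close> and \<open>Y42\<close>, so
    \<open>k $ Y41 = 0\<close> must come first.\<close>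
  moreover from this have "k $ Y42 = 0"
    using curvature_form[of "axis X1 1" "axis X2 1" "axis X3 1"] by (simp add: curvature_form_def axis_nth_if)
  ultimately have "k $ c = 0" if "c \<notin> {XS1, XS2, XS3}" for c
    using that X by (cases c) (simp_all add: x_free_space_def)
  then show "k \<in> star_space" by (simp add: star_space_def)
qed

section \<open>Consequences of admissibility and the algebra of \<open>Xi\<close>\<close>

lemma
  assumes "admissible p q"
  shows admissible_analytic: "real_analytic p" "real_analytic q"
    and admissible_nonzero: "deriv p t \<noteq> 0" "deriv q t \<noteq> 0" "deriv (deriv p) t \<noteq> 0"
    and admissible_second: "deriv (deriv q) t * deriv p t = - deriv (deriv p) t * deriv q t"
proof -
  show an: "real_analytic p" "real_analytic q" using assms by (auto simp: admissible_def)
  have pq: "deriv p t * deriv q t = 1" for t using assms by (auto simp: admissible_def)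
  show "deriv p t \<noteq> 0" "deriv q t \<noteq> 0" using pq[of t] by auto
  show "deriv (deriv p) t \<noteq> 0" using assms by (auto simp: admissible_def numeral_2_eq_2)
  \<comment> \<open>Differentiating the constant product shows that p' and q' have opposite
    logarithmic derivatives. This is the source of the sign that the square in \<open>Xi\<close>
    absorbs.\<close>
  have "((\<lambda>t. deriv p t * deriv q t) has_real_derivative
      deriv p t * deriv (deriv q) t + deriv (deriv p) t * deriv q t) (at t)"
    using an[THEN real_analytic_deriv, THEN real_analytic_DERIV, of t]
    by (auto intro!: derivative_eq_intros)
  moreover have "((\<lambda>t. deriv p t * deriv q t) has_real_derivative 0) (at t)" by (simp add: pq)
  ultimately show "deriv (deriv q) t * deriv p t = - deriv (deriv p) t * deriv q t"
    using DERIV_unique by (fastforce simp: algebra_simps)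
qed

text \<open>Here \<open>p1\<close>, \<open>p2\<close>, \<open>p3\<close> and \<open>r1\<close>,
  \<open>r2\<close>, \<open>r3\<close> stand for the first three derivatives of the source and
  target functions, and \<open>a\<close> for the x_1-derivative of the first component of the
  isometry. \<open>eq\<close> is half the x_1-derivative of \<open>sq\<close>.\<close>

lemma second_order_ratio:
  fixes a p1 p2 p3 r1 r2 r3 :: real
  assumes sq: "(a * r2 * p1)\<^sup>2 = (p2 * r1)\<^sup>2"
    and eq: "a * r2 * p1 * (a\<^sup>2 * r3 * p1 + a * r2 * p2) = p2 * r1 * (p3 * r1 + a * p2 * r2)"
    and nz: "p1 \<noteq> 0" "p2 \<noteq> 0" "r1 \<noteq> 0" "r2 \<noteq> 0"
  shows "(1 - r1 * r3 / r2\<^sup>2)\<^sup>2 = (1 - p1 * p3 / p2\<^sup>2)\<^sup>2"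
proof -
  \<comment> \<open>Multiplying by \<open>r2\<^sup>2 * p1\<close> lets \<open>sq\<close> eliminate
    \<open>a\<close>.\<close>
  have sq': "a\<^sup>2 * r3 * p1 * (r2\<^sup>2 * p1) = r3 * (p2 * r1)\<^sup>2"
    unfolding sq[symmetric] by (simp add: power2_eq_square)
  from sq consider "a * r2 * p1 = p2 * r1" | "a * r2 * p1 = - (p2 * r1)"
    unfolding power2_eq_iff by blast
  then show ?thesis
  proof cases
    case 1
    then have "a\<^sup>2 * r3 * p1 = p3 * r1" using eq nz by simp
    then have "r3 * (p2 * r1)\<^sup>2 = p3 * r1 * (r2\<^sup>2 * p1)" using sq' by simp
    then have "r1 * (r1 * r3 * p2\<^sup>2) = r1 * (p1 * p3 * r2\<^sup>2)"
      by (simp add: power2_eq_square ac_simps)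
    then have "r1 * r3 * p2\<^sup>2 = p1 * p3 * r2\<^sup>2" using nz by simp
    then have "r1 * r3 / r2\<^sup>2 = p1 * p3 / p2\<^sup>2" using nz by (simp add: frac_eq_eq)
    then show ?thesis by simp
  \<comment> \<open>With the opposite sign the terms \<open>a * p2 * r2\<close> add up instead of
    cancelling. Their sum yields the 2 that turns the base of the square into its negative.\<close>
  next
    case 2
    then have "p2 * r1 * (a\<^sup>2 * r3 * p1 + a * r2 * p2) = - (a * r2 * p1 * (a\<^sup>2 * r3 * p1 + a * r2 * p2))"
      by (simp del: mult_eq_0_iff)
    then have "p2 * r1 * (a\<^sup>2 * r3 * p1 + a * r2 * p2) = p2 * r1 * (- (p3 * r1 + a * p2 * r2))"
      unfolding eq mult_minus_right .
    then have "a\<^sup>2 * r3 * p1 + a * r2 * p2 = - (p3 * r1 + a * p2 * r2)" using nz by simp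
    then have "a\<^sup>2 * r3 * p1 = - p3 * r1 - 2 * (a * p2 * r2)" by simp
    then have "r3 * (p2 * r1)\<^sup>2 = (- p3 * r1 - 2 * (a * p2 * r2)) * (r2\<^sup>2 * p1)"
      using sq' by simp
    also have "\<dots> = - p3 * r1 * r2\<^sup>2 * p1 - 2 * (a * r2 * p1) * p2 * r2\<^sup>2"
      by (simp add: algebra_simps)
    also have "\<dots> = r1 * (2 * p2\<^sup>2 * r2\<^sup>2 - p1 * p3 * r2\<^sup>2)"
      unfolding 2 by (simp add: algebra_simps power2_eq_square)
    finally have "r1 * (r1 * r3 * p2\<^sup>2) = r1 * (2 * p2\<^sup>2 * r2\<^sup>2 - p1 * p3 * r2\<^sup>2)"
      by (simp add: power2_eq_square ac_simps)
    then have "r1 * r3 * p2\<^sup>2 = 2 * p2\<^sup>2 * r2\<^sup>2 - p1 * p3 * r2\<^sup>2" using nz by simp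
    then have "1 - r1 * r3 / r2\<^sup>2 = - (1 - p1 * p3 / p2\<^sup>2)"
      using nz by (simp add: field_simps)
    then show ?thesis by (metis power2_minus)
  qed
qed

subsection \<open>Isometries between two metrics of the family\<close>

text \<open>\<open>p\<close>, \<open>q\<close> are the two functions of the source metric, and
  \<open>r\<close>, \<open>s\<close> those of the target.\<close>

locale phi_isometry =
  fixes p q r s :: "real \<Rightarrow> real" and U V :: "R14 set" and F :: "R14 \<Rightarrow> R14"
  assumes admissible_dom: "admissible p q" and admissible_cod: "admissible r s"
    and isometry: "isometry_between (g_Phi p q) U (g_Phi r s) V F"

sublocale phi_isometry \<subseteq> local_isometry "g_Phi p q" "dg_Phi p q" "christoffel p q" "dchristoffel p q"
  "g_Phi r s" "dg_Phi r s" "christoffel r s" "dchristoffel r s" U F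
proof -
  interpret g: levi_civita "g_Phi p q" "dg_Phi p q" "christoffel p q" "dchristoffel p q"
    by (intro levi_civita_g_Phi admissible_analytic[OF admissible_dom])
  interpret h: levi_civita "g_Phi r s" "dg_Phi r s" "christoffel r s" "dchristoffel r s"
    by (intro levi_civita_g_Phi admissible_analytic[OF admissible_cod])
  show "local_isometry (g_Phi p q) (dg_Phi p q) (christoffel p q) (dchristoffel p q)
    (g_Phi r s) (dg_Phi r s) (christoffel r s) (dchristoffel r s) U F"
    by unfold_locales (use isometry in \<open>auto simp: isometry_between_def\<close>)
qed

context phi_isometry
begin

text \<open>The condition in \<open>star_iff\<close> is transported by the invariance of metric and
  curvature; surjectivity of \<open>J P\<close> lets the test vectors range over the whole
  target.\<close>

lemma J_star_iff:
  assumes P: "P \<in> U"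
  shows "J P k \<in> star_space \<longleftrightarrow> k \<in> star_space"
proof -
  have "g_Phi r s (F P) (riemann r s (F P) (J P w) (J P u) (J P v)) (J P k)
     = g_Phi p q P (riemann p q P w u v) k" for w u v
    unfolding curvature_transform[OF P] using pullback[OF P] .
  then have "(\<forall>w u v. g_Phi r s (F P) (riemann r s (F P) w u v) (J P k) = 0)
     \<longleftrightarrow> (\<forall>w u v. g_Phi p q P (riemann p q P w u v) k = 0)"
    using surj_J[OF P] by (metis (no_types))
  then show ?thesis
    unfolding star_iff[OF admissible_nonzero(1,2)[OF admissible_dom], of k P]
      star_iff[OF admissible_nonzero(1,2)[OF admissible_cod], of "J P k" "F P"] .
qed

lemma J_x_free_iff:
  assumes P: "P \<in> U"
  shows "J P v \<in> x_free_space \<longleftrightarrow> v \<in> x_free_space"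
proof -
  have "(\<forall>k\<in>star_space. g_Phi r s (F P) (J P v) k = 0)
     \<longleftrightarrow> (\<forall>k. J P k \<in> star_space \<longrightarrow> g_Phi r s (F P) (J P v) (J P k) = 0)"
    using surj_J[OF P] by (metis (no_types))
  then show ?thesis
    unfolding x_free_iff[of v p q P] x_free_iff[of "J P v" r s "F P"] J_star_iff[OF P] pullback[OF P]
    by blast
qed

lemma D2_eq: "P \<in> U \<Longrightarrow> D2 P u v = J P (christoffel p q P u v) - christoffel r s (F P) (J P u) (J P v)"
  using christoffel_transform[of P u v] by (simp add: algebra_simps)

lemma D2_x_free:
  assumes P: "P \<in> U"
  shows "D2 P u v \<in> x_free_space"
proof -
  have "J P (christoffel p q P u v) \<in> x_free_space"
    using J_x_free_iff[OF P] christoffel_x_free by blast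
  moreover have "christoffel r s (F P) (J P u) (J P v) \<in> x_free_space"
    by (rule christoffel_x_free)
  ultimately show ?thesis
    unfolding D2_eq[OF P] x_free_space_def by simp
qed

text \<open>Together with \<open>D2_x_free\<close> this makes every component of \<open>J\<close>
  that enters \<open>curvature_form\<close> stationary at \<open>P\<close>.\<close>

lemma D2_star:
  assumes P: "P \<in> U" and y: "y \<in> x_free_space"
  shows "D2 P z y \<in> star_space"
proof -
  have "J P (christoffel p q P z y) \<in> star_space"
    using J_star_iff[OF P] christoffel_star[OF y] by blast
  moreover have "christoffel r s (F P) (J P z) (J P y) \<in> star_space"
    using J_x_free_iff[OF P] y by (intro christoffel_star) blast
  ultimately show ?thesis
    unfolding D2_eq[OF P] star_space_def by simp
qed

lemma curvature_form_invariant: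
  assumes P: "P \<in> U" and y: "y \<in> x_free_space"
  shows "curvature_form r s (F P $ X1) (J P w) (J P u) (J P v) (J P y) = curvature_form p q (P $ X1) w u v y"
proof -
  have "g_Phi r s (F P) (riemann r s (F P) (J P w) (J P u) (J P v)) (J P y)
    = g_Phi p q P (riemann p q P w u v) y"
    unfolding curvature_transform[OF P] by (rule pullback[OF P])
  then show ?thesis using J_x_free_iff[OF P, of y] y by (simp add: g_Phi_riemann)
qed

section \<open>Differentiated curvature identities and the invariance of \<open>Xi\<close>\<close>

lemma J_nth_has_derivative:
  assumes "P \<in> U"
  shows "((\<lambda>Q. J Q v $ i) has_derivative (\<lambda>u. D2 P u v $ i)) (at P)"
  by (rule bounded_linear.has_derivative[OF bounded_linear_vec_nth J_has_derivative[OF assms]])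

lemma comp_F_has_derivative:
  assumes "P \<in> U" "real_analytic f"
  shows "((\<lambda>Q. f (F Q $ i)) has_derivative (\<lambda>u. deriv f (F P $ i) * J P u $ i)) (at P)"
  by (rule has_derivative_compose[OF F_has_derivative[OF assms(1)]
    has_derivative_comp_nth[OF real_analytic_DERIV[OF assms(2)]]])

lemma curvature_form_deriv_invariant:
  assumes P: "P \<in> U" and y: "y \<in> x_free_space"
  shows "curvature_form_deriv r s (F P $ X1) (J P z) (J P w) (J P u) (J P v) (J P y) = curvature_form_deriv p q (P $ X1) z w u v y"
proof -
  note an = admissible_analytic[OF admissible_dom, THEN real_analytic_deriv]
    admissible_analytic[OF admissible_cod, THEN real_analytic_deriv]
  note [derivative_intros] = an[THEN comp_F_has_derivative[OF P]]
    an[THEN real_analytic_DERIV, THEN has_derivative_comp_nth]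
  have J0: "((\<lambda>Q. J Q v $ i) has_derivative (\<lambda>_. 0)) (at P)" if "\<And>u. D2 P u v $ i = 0" for v i
    using J_nth_has_derivative[OF P, of v i] that by simp
  have X: "((\<lambda>Q. J Q v $ i) has_derivative (\<lambda>_. 0)) (at P)" if "i \<in> {X1, X2, X3}" for v i
    using that D2_x_free[OF P, of _ v] by (intro J0) (auto simp: x_free_space_def)
  have Y: "((\<lambda>Q. J Q y $ i) has_derivative (\<lambda>_. 0)) (at P)" if "i \<notin> {XS1, XS2, XS3}" for i
    using that D2_star[OF P y] by (intro J0) (auto simp: star_space_def)
  note [derivative_intros] = X[of X1] X[of X2] X[of X3]
    Y[of Y11] Y[of Y12] Y[of Y21] Y[of Y22] Y[of Y31] Y[of Y32] Y[of Y41] Y[of Y42]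
  have "((\<lambda>Q. curvature_form r s (F Q $ X1) (J Q w) (J Q u) (J Q v) (J Q y)) has_derivative
    (\<lambda>z. curvature_form_deriv r s (F P $ X1) (J P z) (J P w) (J P u) (J P v) (J P y))) (at P)"
    unfolding curvature_form_def curvature_form_deriv_def
    by (rule derivative_eq_intros refl | simp add: algebra_simps)+
  from has_derivative_transform_within_open[OF this open_dom P curvature_form_invariant[OF _ y]]
  have 1: "((\<lambda>Q. curvature_form p q (Q $ X1) w u v y) has_derivative
    (\<lambda>z. curvature_form_deriv r s (F P $ X1) (J P z) (J P w) (J P u) (J P v) (J P y))) (at P)" .
  have 2: "((\<lambda>Q. curvature_form p q (Q $ X1) w u v y) has_derivative
    (\<lambda>z. curvature_form_deriv p q (P $ X1) z w u v y)) (at P)"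
    unfolding curvature_form_def curvature_form_deriv_def
    by (rule derivative_eq_intros refl | simp add: algebra_simps)+
  from has_derivative_unique[OF 1 2] show ?thesis by (rule fun_cong)
qed

lemma
  assumes P: "P \<in> U"
  shows J_X1: "J P z $ X1 = z $ X1 * J P (axis X1 1) $ X1"
    and J_X1_nonzero: "J P (axis X1 1) $ X1 \<noteq> 0"
proof -
  have y: "axis Y11 1 \<in> x_free_space" by (simp add: x_free_space_def axis_nth_if)
  \<comment> \<open>\<open>curvature_form_deriv\<close> is proportional to the first component of
    its direction; \<open>b\<close> is the factor on the target side. On the source side the chosen
    vectors give p'', which is non-zero.\<close>
  define b where "b = curvature_form_deriv r s (F P $ X1) (axis X1 1) (J P (axis X1 1)) (J P (axis X3 1))
    (J P (axis X3 1)) (J P (axis Y11 1))"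
  have b: "J P z $ X1 * b = z $ X1 * deriv (deriv p) (P $ X1)" for z
    using curvature_form_deriv_invariant[OF P y, of z "axis X1 1" "axis X3 1" "axis X3 1"]
    by (simp add: b_def curvature_form_deriv_def axis_nth_if)
  note p = admissible_nonzero(3)[OF admissible_dom, of "P $ X1"]
  have "b \<noteq> 0" "J P (axis X1 1) $ X1 \<noteq> 0" using b[of "axis X1 1"] p by (auto simp: axis_nth_if)
  then show "J P (axis X1 1) $ X1 \<noteq> 0" by simp
  have "J P z $ X1 * b = z $ X1 * J P (axis X1 1) $ X1 * b"
    using b[of z] b[of "axis X1 1"] by (simp add: axis_nth_if)
  then show "J P z $ X1 = z $ X1 * J P (axis X1 1) $ X1" using \<open>b \<noteq> 0\<close> by simp
qed

text \<open>Comparing the invariance of \<open>curvature_form_deriv\<close> with that of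
  \<open>curvature_form\<close> on the same vectors eliminates the unknown components of
  \<open>J\<close> and \<open>y\<close>, leaving logarithmic derivatives.\<close>

lemma log_derivative_invariant:
  assumes P: "P \<in> U"
  shows "(J P (axis X1 1) $ X1 * deriv (deriv r) (F P $ X1) * deriv p (P $ X1))\<^sup>2
    = (deriv (deriv p) (P $ X1) * deriv r (F P $ X1))\<^sup>2"
proof -
  define a where "a = J P (axis X1 1) $ X1"
  let ?p' = "deriv p (P $ X1)" let ?p'' = "deriv (deriv p) (P $ X1)"
  let ?q' = "deriv q (P $ X1)" let ?q'' = "deriv (deriv q) (P $ X1)"
  let ?r' = "deriv r (F P $ X1)" let ?r'' = "deriv (deriv r) (F P $ X1)"
  note nz = J_X1_nonzero[OF P, folded a_def] admissible_nonzero[OF admissible_dom, of "P $ X1"]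
    admissible_nonzero[OF admissible_cod, of "F P $ X1"]
  \<comment> \<open>Testing against \<open>\<partial>y\<^sub>1\<^sub>1\<close> leaves a single component of the curvature of the target. Whether it
    corresponds to \<open>\<phi>\<^sub>1\<^sub>1\<close> or to \<open>\<phi>\<^sub>1\<^sub>2\<close> on the source decides the sign.\<close>
  obtain y where y: "J P y = axis Y11 1" using surj_J[OF P] by metis
  then have yx: "y \<in> x_free_space"
    using J_x_free_iff[OF P, of y] by (simp add: x_free_space_def axis_nth_if)
  have J0: "J P (axis X2 1) $ X1 = 0" "J P (axis X3 1) $ X1 = 0"
    using J_X1[OF P, of "axis X2 1"] J_X1[OF P, of "axis X3 1"] by (simp_all add: axis_nth_if)
  define b where "b = J P (axis X2 1) $ X3"
  define c where "c = J P (axis X3 1) $ X3"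
  have 2: "?r' * a * b\<^sup>2 = ?q' * y $ Y12" "a * (?r'' * a * b\<^sup>2) = ?q'' * y $ Y12"
    using curvature_form_invariant[OF P yx, of "axis X1 1" "axis X2 1" "axis X2 1"]
      curvature_form_deriv_invariant[OF P yx, of "axis X1 1" "axis X1 1" "axis X2 1" "axis X2 1"]
    by (simp_all add: curvature_form_def curvature_form_deriv_def y J0 axis_nth_if power2_eq_square mult.assoc flip: a_def b_def)
  have 3: "?r' * a * c\<^sup>2 = ?p' * y $ Y11" "a * (?r'' * a * c\<^sup>2) = ?p'' * y $ Y11"
    using curvature_form_invariant[OF P yx, of "axis X1 1" "axis X3 1" "axis X3 1"]
      curvature_form_deriv_invariant[OF P yx, of "axis X1 1" "axis X1 1" "axis X3 1" "axis X3 1"]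
    by (simp_all add: curvature_form_def curvature_form_deriv_def y J0 axis_nth_if power2_eq_square mult.assoc flip: a_def c_def)
  \<comment> \<open>Otherwise no image vector could equal \<open>axis X3 1\<close>: a preimage has
    no first component, so modulo x-free vectors it combines \<open>axis X2 1\<close> and
    \<open>axis X3 1\<close>.\<close>
  have "b \<noteq> 0 \<or> c \<noteq> 0"
  proof (rule ccontr)
    assume "\<not> (b \<noteq> 0 \<or> c \<noteq> 0)"
    then have bc: "J P (axis X2 1) $ X3 = 0" "J P (axis X3 1) $ X3 = 0" by (simp_all add: b_def c_def)
    obtain z where z: "J P z = axis X3 1" using surj_J[OF P] by metis
    then have "z $ X1 = 0" using J_X1[OF P, of z] nz by (simp add: a_def axis_nth_if)
    then have "z - (z $ X2 *\<^sub>R axis X2 1 + z $ X3 *\<^sub>R axis X3 1) \<in> x_free_space" (is "?n \<in> _")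
      by (simp add: x_free_space_def axis_nth_if)
    then have "J P ?n \<in> x_free_space" using J_x_free_iff[OF P] by blast
    then have "J P ?n $ X3 = 0" unfolding x_free_space_def by blast
    then show False
      using bc z by (simp add: linear_diff[OF linear_J[OF P]] linear_add[OF linear_J[OF P]]
        linear_cmul[OF linear_J[OF P]] axis_nth_if)
  qed
  then have "a * ?r'' * ?p' = ?p'' * ?r' \<or> a * ?r'' * ?p' = - (?p'' * ?r')"
  proof
    assume "c \<noteq> 0"
    have "(a * c\<^sup>2) * (a * ?r'' * ?p') = (a * c\<^sup>2) * (?p'' * ?r')"
      using 3 by algebra
    then show ?thesis using \<open>c \<noteq> 0\<close> nz by simp
  next
    assume "b \<noteq> 0"
    have "(a * b\<^sup>2 * ?q') * (a * ?r'' * ?p') = (a * b\<^sup>2 * ?q') * (- (?p'' * ?r'))"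
      using 2 admissible_second[OF admissible_dom, of "P $ X1"] by algebra
    moreover have "a * b\<^sup>2 * ?q' \<noteq> 0" using \<open>b \<noteq> 0\<close> nz by simp
    ultimately have "a * ?r'' * ?p' = - (?p'' * ?r')" using mult_left_cancel by blast
    then show ?thesis ..
  qed
  then show ?thesis unfolding a_def by (metis power2_minus)
qed

lemma Xi_invariant:
  assumes P: "P \<in> U"
  shows "Xi r (F P) = Xi p P"
proof -
  define a where "a = J P (axis X1 1) $ X1"
  let ?p' = "deriv p (P $ X1)" let ?p'' = "deriv (deriv p) (P $ X1)"
  let ?p3 = "deriv (deriv (deriv p)) (P $ X1)"
  let ?r' = "deriv r (F P $ X1)" let ?r'' = "deriv (deriv r) (F P $ X1)"
  let ?r3 = "deriv (deriv (deriv r)) (F P $ X1)"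
  note nz = J_X1_nonzero[OF P, folded a_def] admissible_nonzero[OF admissible_dom, of "P $ X1"]
    admissible_nonzero[OF admissible_cod, of "F P $ X1"]
  have an: "real_analytic (deriv p)" "real_analytic (deriv (deriv p))"
    "real_analytic (deriv r)" "real_analytic (deriv (deriv r))"
    by (intro real_analytic_deriv admissible_analytic[OF admissible_dom] admissible_analytic[OF admissible_cod])+
  note [derivative_intros] = J_nth_has_derivative[OF P] an[THEN comp_F_has_derivative[OF P]]
    an[THEN real_analytic_DERIV, THEN has_derivative_comp_nth]
  \<comment> \<open>Thus the factor \<open>J Q (axis X1 1) $ X1\<close> contributes nothing when
    \<open>log_derivative_invariant\<close> is differentiated.\<close>
  have [simp]: "D2 P a b $ X1 = 0" for a b
    using D2_x_free[OF P, of a b] by (simp add: x_free_space_def)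
  have "((\<lambda>Q. (J Q (axis X1 1) $ X1 * deriv (deriv r) (F Q $ X1) * deriv p (Q $ X1))\<^sup>2) has_derivative
     (\<lambda>z. 2 * (a * ?r'' * ?p') * (a * ?r3 * J P z $ X1 * ?p' + a * ?r'' * ?p'' * z $ X1))) (at P)"
    by (rule derivative_eq_intros refl | simp add: algebra_simps power2_eq_square a_def)+
  from has_derivative_transform_within_open[OF this open_dom P log_derivative_invariant]
  have 1: "((\<lambda>Q. (deriv (deriv p) (Q $ X1) * deriv r (F Q $ X1))\<^sup>2) has_derivative
     (\<lambda>z. 2 * (a * ?r'' * ?p') * (a * ?r3 * J P z $ X1 * ?p' + a * ?r'' * ?p'' * z $ X1))) (at P)" .
  have 2: "((\<lambda>Q. (deriv (deriv p) (Q $ X1) * deriv r (F Q $ X1))\<^sup>2) has_derivative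
     (\<lambda>z. 2 * (?p'' * ?r') * (?p3 * z $ X1 * ?r' + ?p'' * ?r'' * J P z $ X1))) (at P)"
    by (rule derivative_eq_intros refl | simp add: algebra_simps power2_eq_square)+
  have "2 * (a * ?r'' * ?p') * (a * ?r3 * J P z $ X1 * ?p' + a * ?r'' * ?p'' * z $ X1)
     = 2 * (?p'' * ?r') * (?p3 * z $ X1 * ?r' + ?p'' * ?r'' * J P z $ X1)" for z
    using has_derivative_unique[OF 1 2] by (rule fun_cong)
  \<comment> \<open>In this direction \<open>J P z $ X1\<close> is \<open>a\<close>.\<close>
  from this[of "axis X1 1"] have eq: "(a * ?r'' * ?p') * (a\<^sup>2 * ?r3 * ?p' + a * ?r'' * ?p'')
     = (?p'' * ?r') * (?p3 * ?r' + a * ?p'' * ?r'')"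
    by (simp add: axis_nth_if power2_eq_square algebra_simps flip: a_def)
  have "(1 - ?r' * ?r3 / ?r''\<^sup>2)\<^sup>2 = (1 - ?p' * ?p3 / ?p''\<^sup>2)\<^sup>2"
    using second_order_ratio[OF log_derivative_invariant[OF P, folded a_def] eq] nz by simp
  then show ?thesis by (simp add: Xi_def numeral_2_eq_2 numeral_3_eq_3)
qed

end

section \<open>Locally constant \<open>Xi\<close> forces an exponential\<close>

lemma exponential_if_Xi_locally_constant:
  assumes adm: "admissible p q" and lc: "locally_constant (Xi p)"
  shows "\<exists>b c. \<forall>t. deriv p t = b * exp (c * t)"
proof -
  let ?p1 = "deriv p" let ?p2 = "deriv (deriv p)" let ?p3 = "deriv (deriv (deriv p))"
  have an: "real_analytic ?p1" "real_analytic ?p2" "real_analytic ?p3"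
    by (intro real_analytic_deriv admissible_analytic[OF adm])+
  note nz = admissible_nonzero[OF adm]
  \<comment> \<open>\<open>w\<close> is the derivative of p'/p'', and its square is
    \<open>Xi\<close>.\<close>
  define w where "w t = 1 - ?p1 t * ?p3 t / (?p2 t)\<^sup>2" for t
  have v: "((\<lambda>t. ?p1 t / ?p2 t) has_real_derivative w t) (at t)" for t
    using an[THEN real_analytic_DERIV, of t] nz[of t]
    by (auto intro!: derivative_eq_intros simp: w_def field_simps power2_eq_square)
  have cont: "continuous_on UNIV f" if "real_analytic f" for f
    using real_analytic_DERIV[OF that] by (meson DERIV_isCont continuous_at_imp_continuous_on)
  have cw: "continuous_on UNIV w"
    unfolding w_def[abs_def] using nz by (intro continuous_intros cont an) auto
  have "(w t)\<^sup>2 = (w 0)\<^sup>2" for t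
  proof (rule connected_local_const[of UNIV t 0 "\<lambda>t. (w t)\<^sup>2"])
    show "\<forall>a\<in>UNIV. \<forall>\<^sub>F b in at a within UNIV. (w a)\<^sup>2 = (w b)\<^sup>2"
    proof
      fix a :: real
      \<comment> \<open>Local constancy is restricted to the x_1-axis, where connectedness makes it
        global.\<close>
      obtain W where W: "open W" "axis X1 a \<in> W" "\<And>Q. Q \<in> W \<Longrightarrow> Xi p Q = Xi p (axis X1 a)"
        using lc unfolding locally_constant_def by metis
      have "isCont (\<lambda>t. axis X1 t :: R14) a"
        by (intro linear_continuous_at linear_conv_bounded_linear[THEN iffD1] linearI)
          (auto simp: vec_eq_iff axis_nth_if)
      then have "\<forall>\<^sub>F t in at a. axis X1 t \<in> W"
        using W(1,2) by (intro topological_tendstoD) (auto simp: isCont_def)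
      then show "\<forall>\<^sub>F b in at a within UNIV. (w a)\<^sup>2 = (w b)\<^sup>2"
      proof eventually_elim
        case (elim t)
        show ?case
          using W(3)[OF elim] by (simp add: Xi_def w_def axis_nth_if numeral_2_eq_2 numeral_3_eq_3)
      qed
    qed
  qed auto
  \<comment> \<open>A continuous function with at most two values on the line is constant, which
    fixes the sign of the square root.\<close>
  then have "w t \<in> {w 0, - w 0}" for t by (auto simp: power2_eq_iff)
  then have "finite (range w)" by (intro finite_subset[of "range w" "{w 0, - w 0}"]) auto
  then have "w constant_on UNIV" by (intro continuous_finite_range_constant cw) auto
  then obtain k where k: "\<And>t. w t = k" by (auto simp: constant_on_def)
  have "((\<lambda>t. ?p1 t / ?p2 t - k * t) has_real_derivative 0) (at t)" for t
    using DERIV_diff[OF v[of t] DERIV_cmult_Id[of k t UNIV]] by (simp add: k)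
  then have lin: "?p1 t / ?p2 t - k * t = ?p1 0 / ?p2 0 - k * 0" for t
    by (intro DERIV_isconst_all) auto
  define m where "m = ?p1 0 / ?p2 0"
  have m: "?p1 t / ?p2 t = m + k * t" for t using lin[of t] by (simp add: m_def)
  have m0: "m + k * t \<noteq> 0" for t unfolding m[symmetric] using nz[of t] by simp
  \<comment> \<open>For non-zero \<open>k\<close> the affine function p'/p'' would have the root
    \<open>- m / k\<close>.\<close>
  have "k = 0" using m0[of "- m / k"] by (cases "k = 0") auto
  then have p2: "?p2 t = ?p1 t / m" for t using m[of t] m0[of 0] nz[of t] by (simp add: field_simps)
  \<comment> \<open>An integrating factor for p'' = p'/m.\<close>
  have "((\<lambda>t. ?p1 t * exp (- (t / m))) has_real_derivative 0) (at t)" for t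
    using real_analytic_DERIV[OF an(1), of t] m0[of 0]
    by (auto intro!: derivative_eq_intros simp: p2)
  then have const: "?p1 t * exp (- (t / m)) = ?p1 0 * exp (- (0 / m))" for t
    by (intro DERIV_isconst_all) auto
  define b where "b = ?p1 0 * exp (- (0 / m))"
  note b = const[folded b_def]
  have "?p1 t = b * exp (1 / m * t)" for t
    unfolding b[of t, symmetric] by (simp add: mult.assoc flip: exp_add)
  then show ?thesis by blast
qed

theorem theorem1p7:
  fixes \<phi>11 \<phi>12 :: "real \<Rightarrow> real"
  assumes "admissible \<phi>11 \<phi>12"
  shows "(\<forall>\<psi>11 \<psi>12 U V F. admissible \<psi>11 \<psi>12 \<longrightarrow>
            isometry_between (g_Phi \<phi>11 \<phi>12) U (g_Phi \<psi>11 \<psi>12) V F \<longrightarrow>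
            (\<forall>P\<in>U. Xi \<psi>11 (F P) = Xi \<phi>11 P))
       \<and> (\<not> (\<exists>b c. \<forall>t. deriv \<phi>11 t = b * exp (c * t)) \<longrightarrow>
            \<not> locally_constant (Xi \<phi>11) \<and> \<not> locally_homogeneous (g_Phi \<phi>11 \<phi>12))"
proof -
  have invariant: "Xi \<psi>11 (F P) = Xi \<phi>11 P"
    if "admissible \<psi>11 \<psi>12" "isometry_between (g_Phi \<phi>11 \<phi>12) U (g_Phi \<psi>11 \<psi>12) V F" "P \<in> U"
    for \<psi>11 \<psi>12 U V F P
    using phi_isometry.Xi_invariant[OF phi_isometry.intro[OF assms that(1,2)] that(3)] .
  have "locally_constant (Xi \<phi>11)" if "locally_homogeneous (g_Phi \<phi>11 \<phi>12)"
  proof -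
    \<comment> \<open>Invariance is applied with the same manifold as source and target; local
      homogeneity joins any two points, so \<open>Xi\<close> is even globally constant.\<close>
    have "Xi \<phi>11 Q = Xi \<phi>11 P" for P Q
      using that invariant[OF assms] unfolding locally_homogeneous_def by metis
    then show ?thesis unfolding locally_constant_def by (metis UNIV_I open_UNIV)
  qed
  then show ?thesis
    using invariant exponential_if_Xi_locally_constant[OF assms] by blast
qed

end
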